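(* There exists an absolute constant $C > 0$ such that the following holds for all integers $1 \le m \le n$. Let $K \subset \mathbb{R}^n$ be a convex body and let $F \subset \mathbb{R}^n$ be an $m$-dimensional linear subspace. Then $$ \mathrm{vol}\big((K-K) \cap F\big) \le C^m \, \varphi^m(m,n) \cdot \sup_{x \in \mathbb{R}^n} \mathrm{vol}\big(K \cap (F+x)\big), $$ where $$ \varphi(m,n) = \min\left( \frac{n}{m}, \sqrt{m} \right). $$
   Context: A convex body in $\mathbb{R}^n$ is a compact convex set with nonempty interior. The difference body of $K$ is $K-K = \{ x-y \mid x,y \in K \}$. The symbol $\mathrm{vol}$ denotes volume in the relevant dimension; here it is $m$-dimensional Lebesgue measure on $F$ and on its translates $F+x$. An absolute constant is one that does not depend on $m$, $n$, $K$ or $F$. *)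

theory Defs
  imports "HOL-Analysis.Analysis" "HOL-Library.Function_Algebras"
begin

text \<open>
  The constant of the theorem has to be uniform in the dimension, so the dimension cannot be a type.
  All spaces \<open>\<real>\<^sup>n\<close> are therefore carriers inside the one type \<^typ>\<open>nat \<Rightarrow> real\<close>:
  \<open>\<real>\<^sup>n\<close> is the set of functions vanishing from index \<open>n\<close> on, i.e. the
  underlying set of \<^term>\<open>Euclidean_space n\<close>. Pointwise scaling makes \<^const>\<open>subspace\<close>,
  \<^const>\<open>dim\<close>, \<^const>\<open>span\<close> and \<^const>\<open>convex\<close> available on this type.
\<close>

instantiation "fun" :: (type, real_vector) real_vector
begin

definition scaleR_fun :: "real \<Rightarrow> ('a \<Rightarrow> 'b) \<Rightarrow> 'a \<Rightarrow> 'b"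
  where "scaleR_fun c f = (\<lambda>i. c *\<^sub>R f i)"

instance
  by standard (simp_all add: scaleR_fun_def fun_eq_iff scaleR_add_left scaleR_add_right)

end

abbreviation Rn :: "nat \<Rightarrow> (nat \<Rightarrow> real) set"
  where "Rn n \<equiv> topspace (Euclidean_space n)"

definition convex_body :: "nat \<Rightarrow> (nat \<Rightarrow> real) set \<Rightarrow> bool"
  where "convex_body n K \<longleftrightarrow>
    compactin (Euclidean_space n) K \<and> convex K \<and> Euclidean_space n interior_of K \<noteq> {}"

definition difference_body :: "(nat \<Rightarrow> real) set \<Rightarrow> (nat \<Rightarrow> real) set"
  where "difference_body K = {x - y | x y. x \<in> K \<and> y \<in> K}"

definition dot :: "nat \<Rightarrow> (nat \<Rightarrow> real) \<Rightarrow> (nat \<Rightarrow> real) \<Rightarrow> real"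
  where "dot n x y = (\<Sum>i<n. x i * y i)"

definition orthonormal_basis ::
    "nat \<Rightarrow> (nat \<Rightarrow> real) set \<Rightarrow> (nat \<Rightarrow> nat \<Rightarrow> real) \<Rightarrow> bool"
  where "orthonormal_basis n F u \<longleftrightarrow>
    (\<forall>i<dim F. \<forall>j<dim F. dot n (u i) (u j) = (if i = j then 1 else 0)) \<and>
    span (u ` {..<dim F}) = F"

text \<open>
  Lebesgue measure of dimension \<^term>\<open>dim F\<close> on the translate \<open>F + x\<close> of a linear
  subspace \<open>F\<close> of \<open>\<real>\<^sup>n\<close>: the image of Lebesgue measure on \<open>\<real>\<^sup>m\<close>,
  \<open>m = dim F\<close>, under an isometry of \<open>\<real>\<^sup>m\<close> onto \<open>F + x\<close>. Such a basis exists
  (lemma \<open>orthonormal_basis_exists\<close> below), and by the orthogonal and translation invariance of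
  Lebesgue measure the result depends neither on the chosen basis nor on the base point within
  \<open>F + x\<close>.
\<close>

definition flat_lborel :: "nat \<Rightarrow> (nat \<Rightarrow> real) set \<Rightarrow> (nat \<Rightarrow> real) \<Rightarrow> (nat \<Rightarrow> real) measure"
  where "flat_lborel n F x =
    (let u = (SOME u. orthonormal_basis n F u)
     in distr (\<Pi>\<^sub>M j\<in>{..<dim F}. lborel) borel (\<lambda>t. x + (\<Sum>j<dim F. t j *\<^sub>R u j)))"

definition phi :: "nat \<Rightarrow> nat \<Rightarrow> real"
  where "phi m n = min (real n / real m) (sqrt (real m))"

lemma sum_fun_apply: "(\<Sum>j\<in>A. f j) i = (\<Sum>j\<in>A. f j i)"
  for f :: "'a \<Rightarrow> 'b \<Rightarrow> 'c::comm_monoid_add"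
  by (induction A rule: infinite_finite_induct) auto

lemma scaleR_fun_apply [simp]: "(c *\<^sub>R f) i = c *\<^sub>R f i"
  by (simp add: scaleR_fun_def)

lemma subspace_Rn: "subspace (Rn n)"
  by (auto simp: subspace_def topspace_Euclidean_space)

lemma dot_simps:
  "dot n (x + y) z = dot n x z + dot n y z" "dot n (x - y) z = dot n x z - dot n y z"
  "dot n (c *\<^sub>R x) z = c * dot n x z" "dot n 0 z = 0" "dot n z x = dot n x z"
  by (simp_all add: dot_def algebra_simps sum.distrib sum_subtractf sum_distrib_left)

lemma dot_sum: "dot n (\<Sum>j\<in>A. f j) z = (\<Sum>j\<in>A. dot n (f j) z)"
  by (simp add: dot_def sum_fun_apply sum_distrib_right) (rule sum.swap)

lemma dot_self_pos:
  assumes "x \<in> Rn n" "x \<noteq> 0"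
  shows "dot n x x > 0"
proof -
  obtain i where i: "x i \<noteq> 0" using assms(2) by (auto simp: fun_eq_iff)
  then have "i < n" using assms(1) by (force simp: topspace_Euclidean_space not_le[symmetric])
  then show ?thesis unfolding dot_def
    by (intro sum_pos2[of _ i]) (use i in \<open>auto simp: zero_less_mult_iff\<close>)
qed

lemma orthonormal_independent:
  assumes on: "\<And>i j. i < k \<Longrightarrow> j < k \<Longrightarrow> dot n (u i) (u j) = (if i = j then 1 else 0)"
  shows "independent (u ` {..<k})" "inj_on u {..<k}"
proof -
  show inj: "inj_on u {..<k}"
    by (rule inj_onI) (metis lessThan_iff on zero_neq_one)
  show "independent (u ` {..<k})"
    unfolding independent_explicit_finite_subsets
  proof (intro allI impI ballI)
    fix S c v assume S: "S \<subseteq> u ` {..<k}" "finite S"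
      and s: "(\<Sum>v\<in>S. c v *\<^sub>R v) = 0" and v: "v \<in> S"
    have "0 = dot n (\<Sum>w\<in>S. c w *\<^sub>R w) v" by (simp add: s dot_simps(4))
    also have "\<dots> = (\<Sum>w\<in>S. c w * dot n w v)" by (simp add: dot_sum dot_simps(3))
    also have "\<dots> = (\<Sum>w\<in>S. if w = v then c w else 0)"
    proof (intro sum.cong refl)
      fix w assume "w \<in> S"
      then obtain i j where "w = u i" "v = u j" "i < k" "j < k" using S(1) v by blast
      moreover from this have "u i = u j \<longleftrightarrow> i = j" using inj by (simp add: inj_on_eq_iff)
      ultimately show "c w * dot n w v = (if w = v then c w else 0)" by (simp add: on)
    qed
    also have "\<dots> = c v" using S v by simp
    finally show "c v = 0" by simp
  qed
qed

lemma orthonormal_span: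
  assumes "finite S" "S \<subseteq> Rn n"
  shows "\<exists>u (k::nat). (\<forall>i<k. \<forall>j<k. dot n (u i) (u j) = (if i = j then 1 else 0)) \<and>
    span (u ` {..<k}) = span S"
  using assms
proof (induction S)
  case empty
  show ?case by (rule exI[of _ "\<lambda>_. 0"], rule exI[of _ 0]) simp
next
  case (insert a S)
  then obtain u and k :: nat
    where on: "\<And>i j. i < k \<Longrightarrow> j < k \<Longrightarrow> dot n (u i) (u j) = (if i = j then 1 else 0)"
    and sp: "span (u ` {..<k}) = span S"
    using insert.IH[OF order_trans[OF subset_insertI insert.prems]] by blast
  define p where "p = (\<Sum>j<k. dot n a (u j) *\<^sub>R u j)"
  define b where "b = a - p"
  have pS: "p \<in> span S"
    unfolding p_def sp[symmetric] by (intro span_sum span_scale span_base) auto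
  have "b - a \<in> span S"
    using pS span_neg by (force simp: b_def algebra_simps)
  then have spb: "span (insert b S) = span (insert a S)"
    by (rule eq_span_insert_eq)
  have "span S \<subseteq> Rn n"
    using insert.prems subspace_Rn by (intro span_minimal) auto
  then have bR: "b \<in> Rn n"
    unfolding b_def using pS insert.prems by (intro subspace_diff[OF subspace_Rn]) auto
  have orth: "dot n b (u i) = 0" if "i < k" for i
  proof -
    have "dot n p (u i) = (\<Sum>j<k. dot n a (u j) * dot n (u j) (u i))"
      by (simp only: p_def dot_sum dot_simps(3))
    also have "\<dots> = (\<Sum>j<k. if j = i then dot n a (u j) else 0)"
      by (intro sum.cong refl) (use on that in auto)
    also have "\<dots> = dot n a (u i)" using that by simp
    finally show ?thesis by (simp only: b_def dot_simps(2))
  qed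
  show ?case
  proof (cases "b = 0")
    case True
    then have "span (u ` {..<k}) = span (insert a S)"
      using spb sp by (simp only: span_insert_0)
    with on show ?thesis by blast
  next
    case False
    define q where "q = sqrt (dot n b b)"
    have q: "q > 0" "q * q = dot n b b"
      using dot_self_pos[OF bR False] by (simp_all add: q_def)
    define v where "v = u(k := (1 / q) *\<^sub>R b)"
    have "dot n (v i) (v j) = (if i = j then 1 else 0)" if "i < Suc k" "j < Suc k" for i j
    proof -
      have "dot n (u i) b = 0" if "i < k" for i
        using orth[OF that] by (simp only: dot_simps(5)[of n "u i" b])
      moreover have "dot n (c *\<^sub>R x) (c *\<^sub>R y) = c * c * dot n x y"
        "dot n x (c *\<^sub>R y) = c * dot n x y" for c x y
        by (simp_all add: dot_def sum_distrib_left mult_ac)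
      ultimately show ?thesis
        using that on orth q by (auto simp: v_def less_Suc_eq dot_simps(3) simp del: scaleR_fun_apply)
    qed
    moreover have "span (v ` {..<Suc k}) = span (insert a S)"
    proof -
      have "v ` {..<Suc k} = insert ((1 / q) *\<^sub>R b) (u ` {..<k})"
        by (auto simp: v_def lessThan_Suc)
      moreover have "span (insert ((1 / q) *\<^sub>R b) (u ` {..<k})) = span (insert b (u ` {..<k}))"
      proof (rule span_eq[THEN iffD2], intro conjI insert_subsetI)
        show "(1 / q) *\<^sub>R b \<in> span (insert b (u ` {..<k}))"
          by (intro span_scale span_base) simp
        have "q *\<^sub>R (1 / q) *\<^sub>R b \<in> span (insert ((1 / q) *\<^sub>R b) (u ` {..<k}))"
          by (rule span_scale[OF span_base]) simp
        then show "b \<in> span (insert ((1 / q) *\<^sub>R b) (u ` {..<k}))"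
          using q(1) by (simp only: scaleR_scaleR) simp
      qed (meson span_base subset_iff subset_insertI)+
      moreover have "span (insert b (u ` {..<k})) = span (insert b S)"
        unfolding span_insert sp ..
      ultimately show ?thesis using spb by simp
    qed
    ultimately show ?thesis by blast
  qed
qed

lemma Rn_subset_span: "Rn n \<subseteq> span ((\<lambda>k i. if i = k then 1 else 0) ` {..<n})"
proof
  fix x assume x: "x \<in> Rn n"
  have "x = (\<Sum>k<n. x k *\<^sub>R (\<lambda>i. if i = k then 1 else 0))"
    using x by (auto simp: fun_eq_iff sum_fun_apply topspace_Euclidean_space if_distrib cong: if_cong)
  also have "\<dots> \<in> span ((\<lambda>k i. if i = k then 1 else 0) ` {..<n})"
    by (intro span_sum span_scale span_base) auto
  finally show "x \<in> span ((\<lambda>k i. if i = k then 1 else 0) ` {..<n})" .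
qed

lemma orthonormal_basis_exists:
  assumes "subspace F" "F \<subseteq> Rn n"
  shows "\<exists>u. orthonormal_basis n F u"
proof -
  obtain B where B: "B \<subseteq> F" "independent B" "F \<subseteq> span B" "card B = dim F"
    using basis_exists by blast
  have "finite B"
    using independent_span_bound[OF _ B(2) order_trans[OF B(1) order_trans[OF assms(2) Rn_subset_span]]]
    by simp
  then obtain u and k :: nat
    where on: "\<And>i j. i < k \<Longrightarrow> j < k \<Longrightarrow> dot n (u i) (u j) = (if i = j then 1 else 0)"
    and "span (u ` {..<k}) = span B"
    using orthonormal_span[OF _ order_trans[OF B(1) assms(2)]] by blast
  moreover have "span B = F"
    using B assms(1) by (meson span_minimal subset_antisym)
  ultimately have sp: "span (u ` {..<k}) = F" by simp
  have "dim F = card (u ` {..<k})"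
    using dim_eq_card[of "u ` {..<k}" F] sp orthonormal_independent(1)[OF on]
    by (metis span_span)
  then have "dim F = k"
    using orthonormal_independent(2)[OF on] by (simp add: card_image)
  then show ?thesis using on sp unfolding orthonormal_basis_def by blast
qed

end

theory Submission
  imports Defs "HOL-Probability.Distributions"
begin

text \<open>
  Let \<open>L = (K - K) \<inter> F\<close>. For the bound \<open>(C n / m)\<^sup>m\<close> one integrates \<open>vol (K \<inter> (K - t))\<close> over
  \<open>t \<in> \<theta> L\<close> with \<open>\<theta> = m / 2n\<close>: the integrand is at least \<open>(1 - \<theta>)\<^sup>n vol K\<close>, and by Fubini the
  integral is at most \<open>vol K\<close> times the largest section of \<open>K\<close> parallel to \<open>F\<close>.

  For the bound \<open>(C \<surd>m)\<^sup>m\<close>, every \<open>x\<^sub>k \<in> L\<close> is the direction of a segment \<open>[b\<^sub>k, b\<^sub>k + x\<^sub>k]\<close> in \<open>K\<close>,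
  and averaging \<open>m\<close> of them puts a translate of the parallelepiped \<open>(1 / m) \<Sum>\<^sub>k [0, x\<^sub>k]\<close> into a
  section of \<open>K\<close>. Choose linear functionals \<open>f\<^sub>k\<close> that are orthonormal with respect to the uniform
  distribution on \<open>L\<close>, together with points \<open>x\<^sub>k \<in> L\<close> such that the matrix \<open>f\<^sub>j(x\<^sub>k)\<close> is triangular with
  diagonal entries at least \<open>\<surd>(k + 1)\<close>; such points exist because the mean of
  \<open>f\<^sub>0\<^sup>2 + \<dots> + f\<^sub>k\<^sup>2\<close> over \<open>L\<close> is \<open>k + 1\<close>. In the coordinates \<open>f\<close>, the parallelepiped then has volume
  at least \<open>\<surd>(m!) / m\<^sup>m\<close>, whereas \<open>L\<close> has volume at most \<open>C\<^sup>m\<close> by comparison with the Gaussian.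
\<close>

section \<open>Affine changes of variables\<close>

abbreviation leb :: "nat \<Rightarrow> (nat \<Rightarrow> real) measure"
  where "leb m \<equiv> \<Pi>\<^sub>M j\<in>{..<m}. lborel"

lemma leb_Suc_nn_integral:
  assumes "g \<in> borel_measurable (leb (Suc m))"
  shows "(\<integral>\<^sup>+x. g x \<partial>leb (Suc m)) = (\<integral>\<^sup>+x. (\<integral>\<^sup>+s. g (x(m := s)) \<partial>lborel) \<partial>leb m)"
proof -
  interpret product_sigma_finite "\<lambda>_::nat. lborel :: real measure" ..
  show ?thesis
    using product_nn_integral_insert[of "{..<m}" m g] assms by (simp add: lessThan_Suc)
qed

lemma sigma_finite_leb: "sigma_finite_measure (leb m)"
proof -
  interpret product_sigma_finite "\<lambda>_::nat. lborel :: real measure" ..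
  interpret finite_product_sigma_finite "\<lambda>_::nat. lborel :: real measure" "{..<m}" by standard simp
  show ?thesis by unfold_locales
qed

lemma measurable_leb_upd [measurable]:
  "(\<lambda>(x, s). x(m := s)) \<in> leb m \<Otimes>\<^sub>M lborel \<rightarrow>\<^sub>M leb (Suc m)"
  unfolding lessThan_Suc by (rule measurable_add_dim)

text \<open>An affine map with lower triangular matrix \<open>c\<close>. The value is restricted to
  the indices below \<open>m\<close> because the points of \<open>leb m\<close> are extensional
  functions.\<close>

definition lower :: "nat \<Rightarrow> (nat \<Rightarrow> real) \<Rightarrow> (nat \<Rightarrow> nat \<Rightarrow> real) \<Rightarrow> (nat \<Rightarrow> real) \<Rightarrow> nat \<Rightarrow> real"
  where "lower m b c t = (\<lambda>j\<in>{..<m}. b j + (\<Sum>k\<le>j. c j k * t k))"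

lemma measurable_leb_coord [measurable]: "i < m \<Longrightarrow> (\<lambda>t. t i) \<in> borel_measurable (leb m)"
  by (metis lessThan_iff measurable_component_singleton measurable_lborel1)

lemma measurable_leb_sum:
  "(\<lambda>t. \<Sum>k\<in>A. c k * t k) \<in> borel_measurable (leb m)" if "A \<subseteq> {..<m}"
  using that by (intro borel_measurable_sum borel_measurable_times) auto

lemma measurable_lower [measurable]: "lower m b c \<in> leb m \<rightarrow>\<^sub>M leb m"
  unfolding lower_def
proof (rule measurable_restrict)
  fix j assume "j \<in> {..<m}"
  then show "(\<lambda>t. b j + (\<Sum>k\<le>j. c j k * t k)) \<in> leb m \<rightarrow>\<^sub>M lborel"
    using measurable_leb_sum[of "{..j}" m "c j"] by simp
qed

text \<open>By triangularity the last variable occurs only in the last entry. With the others fixed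
  it undergoes a one-dimensional affine map of slope \<open>c m m\<close>, and integrating it out
  first leaves the same problem in one dimension less.\<close>

lemma nn_integral_lower:
  assumes "g \<in> borel_measurable (leb m)" "\<And>j. j < m \<Longrightarrow> c j j \<noteq> 0"
  shows "ennreal (\<Prod>j<m. \<bar>c j j\<bar>) * (\<integral>\<^sup>+t. g (lower m b c t) \<partial>leb m) = (\<integral>\<^sup>+t. g t \<partial>leb m)"
  using assms
proof (induction m arbitrary: g)
  case 0
  then show ?case by (simp add: PiM_empty nn_integral_count_space_finite lower_def)
next
  case (Suc m)
  note [measurable] = Suc.prems(1)
  have c: "c m m \<noteq> 0" using Suc.prems by simp
  let ?h = "\<lambda>t. b m + (\<Sum>k<m. c m k * t k)"
  define G where "G y = (\<integral>\<^sup>+s. g (y(m := s)) \<partial>lborel)" for y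
  interpret sigma_finite_measure "lborel :: real measure" by (rule lborel.sigma_finite_measure_axioms)
  have [measurable]: "G \<in> borel_measurable (leb m)" unfolding G_def by measurable
  have "(\<integral>\<^sup>+s. g (lower (Suc m) b c (t(m := s))) \<partial>lborel) * \<bar>c m m\<bar> = G (lower m b c t)"
    if t: "t \<in> space (leb m)" for t
  proof -
    have eq: "lower (Suc m) b c (t(m := s)) = (lower m b c t)(m := ?h t + c m m * s)" for s
      by (auto simp: lower_def fun_eq_iff lessThan_Suc_atMost[symmetric] intro!: sum.cong)
    have "lower m b c t \<in> space (leb m)" using measurable_space[OF measurable_lower t] .
    then have [measurable]: "(\<lambda>s. g ((lower m b c t)(m := s))) \<in> borel_measurable borel"
      by simp
    show ?thesis unfolding eq G_def
      using nn_integral_real_affine[of "\<lambda>s. g ((lower m b c t)(m := s))" "c m m" "?h t"] c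
      by (simp add: mult.commute)
  qed
  note inner = this
  have "ennreal (\<Prod>j<Suc m. \<bar>c j j\<bar>) * (\<integral>\<^sup>+t. g (lower (Suc m) b c t) \<partial>leb (Suc m)) =
    ennreal (\<Prod>j<m. \<bar>c j j\<bar>) * ((\<integral>\<^sup>+t. (\<integral>\<^sup>+s. g (lower (Suc m) b c (t(m := s))) \<partial>lborel) \<partial>leb m) * \<bar>c m m\<bar>)"
    by (subst leb_Suc_nn_integral) (simp_all add: ennreal_mult prod_nonneg mult_ac)
  also have "\<dots> = ennreal (\<Prod>j<m. \<bar>c j j\<bar>) * (\<integral>\<^sup>+t. (\<integral>\<^sup>+s. g (lower (Suc m) b c (t(m := s))) \<partial>lborel) * \<bar>c m m\<bar> \<partial>leb m)"
    by (subst nn_integral_multc) simp_all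
  also have "\<dots> = ennreal (\<Prod>j<m. \<bar>c j j\<bar>) * (\<integral>\<^sup>+t. G (lower m b c t) \<partial>leb m)"
    using inner by (simp cong: nn_integral_cong)
  also have "\<dots> = (\<integral>\<^sup>+t. G t \<partial>leb m)" by (rule Suc.IH) (use Suc.prems in auto)
  also have "\<dots> = (\<integral>\<^sup>+t. g t \<partial>leb (Suc m))" unfolding G_def by (subst leb_Suc_nn_integral) simp_all
  finally show ?case .
qed

text \<open>Forward substitution: equation \<open>m\<close> determines coordinate \<open>m\<close>,
  which the earlier equations do not contain.\<close>

lemma lower_surj:
  fixes m :: nat and c :: "nat \<Rightarrow> nat \<Rightarrow> real"
  assumes "\<And>j. j < m \<Longrightarrow> c j j \<noteq> 0"
  shows "\<exists>t. \<forall>j<m. b j + (\<Sum>k\<le>j. c j k * t k) = y j"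
  using assms
proof (induction m)
  case (Suc m)
  then obtain t where t: "\<forall>j<m. b j + (\<Sum>k\<le>j. c j k * t k) = y j" by auto
  have c: "c m m \<noteq> 0" using Suc.prems by simp
  define t' where "t' = t(m := (y m - b m - (\<Sum>k<m. c m k * t k)) / c m m)"
  have "(\<Sum>k\<le>j. c j k * t' k) = (\<Sum>k\<le>j. c j k * t k)" if "j < m" for j
    using that by (intro sum.cong) (auto simp: t'_def)
  moreover have "(\<Sum>k<m. c m k * t' k) = (\<Sum>k<m. c m k * t k)"
    by (intro sum.cong) (auto simp: t'_def)
  then have "b m + (\<Sum>k\<le>m. c m k * t' k) = y m"
    using c by (simp add: t'_def lessThan_Suc_atMost[symmetric])
  ultimately show ?case using t by (intro exI[of _ t']) (auto simp: less_Suc_eq)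
qed simp

lemma nn_integral_leb_translate:
  assumes "g \<in> borel_measurable (leb m)"
  shows "(\<integral>\<^sup>+t. g (\<lambda>j\<in>{..<m}. b j + t j) \<partial>leb m) = (\<integral>\<^sup>+t. g t \<partial>leb m)"
proof -
  have "lower m b (\<lambda>j k. if j = k then 1 else 0) t = (\<lambda>j\<in>{..<m}. b j + t j)" for t
    by (auto simp: lower_def fun_eq_iff if_distrib[of "\<lambda>x. x * _"] cong: if_cong)
  then show ?thesis
    using nn_integral_lower[OF assms, of "\<lambda>j k. if j = k then 1 else 0" b] by simp
qed

lemma nn_integral_leb_scale:
  assumes "g \<in> borel_measurable (leb m)" "c > 0"
  shows "ennreal (c ^ m) * (\<integral>\<^sup>+t. g (\<lambda>j\<in>{..<m}. b j + c * t j) \<partial>leb m) = (\<integral>\<^sup>+t. g t \<partial>leb m)"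
proof -
  have "lower m b (\<lambda>j k. if j = k then c else 0) t = (\<lambda>j\<in>{..<m}. b j + c * t j)" for t
    by (auto simp: lower_def fun_eq_iff if_distrib[of "\<lambda>x. x * _"] cong: if_cong)
  then show ?thesis
    using nn_integral_lower[OF assms(1), of "\<lambda>j k. if j = k then c else 0" b] assms(2) by simp
qed

lemma emeasure_leb_cube: "emeasure (leb m) (\<Pi>\<^sub>E j\<in>{..<m}. {a..a+c}) = ennreal (c ^ m)" if "c \<ge> 0"
proof -
  interpret product_sigma_finite "\<lambda>_::nat. lborel :: real measure" ..
  show ?thesis using that by (subst emeasure_PiM) (simp_all add: prod_constant ennreal_power)
qed

definition lin :: "nat \<Rightarrow> (nat \<Rightarrow> nat \<Rightarrow> real) \<Rightarrow> (nat \<Rightarrow> real) \<Rightarrow> nat \<Rightarrow> real"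
  where "lin m f x = (\<lambda>j\<in>{..<m}. dot m (f j) x)"

lemma measurable_dot [measurable]: "dot m v \<in> borel_measurable (leb m)"
  unfolding dot_def by measurable

lemma measurable_leb_restrict:
  assumes "\<And>j. j < m \<Longrightarrow> (\<lambda>x. F x j) \<in> borel_measurable M"
  shows "(\<lambda>x. \<lambda>j\<in>{..<m}. F x j) \<in> M \<rightarrow>\<^sub>M leb m"
  using assms by (intro measurable_restrict) simp

lemma measurable_lin [measurable]: "lin m f \<in> leb m \<rightarrow>\<^sub>M leb m"
  unfolding lin_def by (intro measurable_leb_restrict) simp

lemma dot_restrict [simp]: "dot m v (restrict x {..<m}) = dot m v x"
  by (simp add: dot_def)

lemma dot_add_right: "dot m v (\<lambda>j. x j + y j) = dot m v x + dot m v y"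
  by (simp add: dot_def algebra_simps sum.distrib)

text \<open>
  Uniqueness of translation-invariant measures. With \<open>q\<close> the indicator of the unit cube,
  \<open>\<integral>\<integral> q(y) g(\<Phi> x) dx dy\<close> is evaluated by shifting \<open>x\<close> so that \<open>\<Phi> x\<close> becomes
  \<open>y + \<Phi> x\<close>, exchanging the integrals, and shifting back in \<open>y\<close>. No determinant is needed,
  because \<open>\<kappa>\<close> cancels in the application.
\<close>

lemma nn_integral_lin:
  fixes f :: "nat \<Rightarrow> nat \<Rightarrow> real"
  assumes surj: "\<And>y. \<exists>x. \<forall>j<m. dot m (f j) x = y j"
  shows "\<exists>\<kappa>. \<forall>g\<in>borel_measurable (leb m).
    (\<integral>\<^sup>+x. g (lin m f x) \<partial>leb m) = \<kappa> * (\<integral>\<^sup>+y. g y \<partial>leb m)"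
proof -
  interpret L: sigma_finite_measure "leb m" by (rule sigma_finite_leb)
  interpret LL: pair_sigma_finite "leb m" "leb m" ..
  define Q where "Q = (\<Pi>\<^sub>E j\<in>{..<m}. {0..1::real})"
  have [measurable]: "Q \<in> sets (leb m)" unfolding Q_def by (intro sets_PiM_I_finite) auto
  define q :: "(nat \<Rightarrow> real) \<Rightarrow> ennreal" where "q = indicator Q"
  have [measurable]: "q \<in> borel_measurable (leb m)" unfolding q_def by measurable
  have q1: "(\<integral>\<^sup>+y. q y \<partial>leb m) = 1"
    unfolding q_def using emeasure_leb_cube[of 1 m 0] by (simp add: Q_def[symmetric])
  have transl: "(\<integral>\<^sup>+x. h (lin m f x) \<partial>leb m) = (\<integral>\<^sup>+x. h (\<lambda>j\<in>{..<m}. y j + lin m f x j) \<partial>leb m)"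
    if [measurable]: "h \<in> borel_measurable (leb m)" for h :: "_ \<Rightarrow> ennreal" and y
  proof -
    obtain w where w: "\<forall>j<m. dot m (f j) w = y j" using surj by blast
    have "lin m f (\<lambda>j\<in>{..<m}. w j + x j) = (\<lambda>j\<in>{..<m}. y j + lin m f x j)" for x
      using w by (auto simp: lin_def dot_add_right fun_eq_iff)
    then show ?thesis
      using nn_integral_leb_translate[of "\<lambda>x. h (lin m f x)" m w] by simp
  qed
  \<comment> \<open>The inner integral over \<open>x\<close> takes this value once \<open>y\<close>
    has been shifted away, so the factor depends neither on \<open>y\<close> nor on
    \<open>g\<close>.\<close>
  define \<kappa> where "\<kappa> = (\<integral>\<^sup>+x. q (\<lambda>j\<in>{..<m}. - lin m f x j) \<partial>leb m)"
  have mlin: "(\<lambda>x. lin m f x j) \<in> borel_measurable (leb m)" if "j < m" for j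
    using that by (simp add: lin_def)
  have "(\<integral>\<^sup>+x. g (lin m f x) \<partial>leb m) = \<kappa> * (\<integral>\<^sup>+y. g y \<partial>leb m)"
    if [measurable]: "g \<in> borel_measurable (leb m)" for g
  proof -
    have [measurable]: "(\<lambda>(x, y). \<lambda>j\<in>{..<m}. y j + lin m f x j) \<in> leb m \<Otimes>\<^sub>M leb m \<rightarrow>\<^sub>M leb m"
      "(\<lambda>(x, y). \<lambda>j\<in>{..<m}. y j - lin m f x j) \<in> leb m \<Otimes>\<^sub>M leb m \<rightarrow>\<^sub>M leb m"
      unfolding case_prod_beta'
      by (intro measurable_leb_restrict borel_measurable_add borel_measurable_diff
          measurable_compose[OF measurable_snd measurable_leb_coord]
          measurable_compose[OF measurable_fst mlin]; simp)+
    have [measurable]: "(\<lambda>x. \<lambda>j\<in>{..<m}. z j - x j) \<in> leb m \<rightarrow>\<^sub>M leb m"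
      "(\<lambda>x. \<lambda>j\<in>{..<m}. x j - z j) \<in> leb m \<rightarrow>\<^sub>M leb m" for z
      by (intro measurable_leb_restrict; simp)+
    have "(\<integral>\<^sup>+x. g (lin m f x) \<partial>leb m) = (\<integral>\<^sup>+y. q y * (\<integral>\<^sup>+x. g (lin m f x) \<partial>leb m) \<partial>leb m)"
      by (simp add: nn_integral_multc q1)
    also have "\<dots> = (\<integral>\<^sup>+y. q y * (\<integral>\<^sup>+x. g (\<lambda>j\<in>{..<m}. y j + lin m f x j) \<partial>leb m) \<partial>leb m)"
      using transl[of g] by simp
    also have "\<dots> = (\<integral>\<^sup>+y. (\<integral>\<^sup>+x. q y * g (\<lambda>j\<in>{..<m}. y j + lin m f x j) \<partial>leb m) \<partial>leb m)"
      by (intro nn_integral_cong nn_integral_cmult[symmetric]) measurable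
    also have "\<dots> = (\<integral>\<^sup>+x. (\<integral>\<^sup>+y. q y * g (\<lambda>j\<in>{..<m}. y j + lin m f x j) \<partial>leb m) \<partial>leb m)"
      by (rule LL.Fubini') measurable
    also have "\<dots> = (\<integral>\<^sup>+x. (\<integral>\<^sup>+y. q (\<lambda>j\<in>{..<m}. y j - lin m f x j) * g y \<partial>leb m) \<partial>leb m)"
    proof (rule nn_integral_cong)
      fix x
      let ?h = "\<lambda>y. q (\<lambda>j\<in>{..<m}. y j - lin m f x j) * g y"
      have "(\<integral>\<^sup>+y. ?h y \<partial>leb m) = (\<integral>\<^sup>+y. ?h (\<lambda>j\<in>{..<m}. lin m f x j + y j) \<partial>leb m)"
        by (rule nn_integral_leb_translate[symmetric]) measurable
      also have "\<dots> = (\<integral>\<^sup>+y. q y * g (\<lambda>j\<in>{..<m}. y j + lin m f x j) \<partial>leb m)"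
      proof (rule nn_integral_cong)
        fix y assume "y \<in> space (leb m)"
        then have "(\<lambda>j\<in>{..<m}. (\<lambda>j\<in>{..<m}. lin m f x j + y j) j - lin m f x j) = y"
          by (auto simp: fun_eq_iff space_PiM PiE_def extensional_def)
        then show "?h (\<lambda>j\<in>{..<m}. lin m f x j + y j) = q y * g (\<lambda>j\<in>{..<m}. y j + lin m f x j)"
          by (simp add: add.commute cong: restrict_cong)
      qed
      finally show "(\<integral>\<^sup>+y. q y * g (\<lambda>j\<in>{..<m}. y j + lin m f x j) \<partial>leb m) = (\<integral>\<^sup>+y. ?h y \<partial>leb m)" ..
    qed
    also have "\<dots> = (\<integral>\<^sup>+y. (\<integral>\<^sup>+x. q (\<lambda>j\<in>{..<m}. y j - lin m f x j) * g y \<partial>leb m) \<partial>leb m)"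
      by (rule LL.Fubini') measurable
    also have "\<dots> = (\<integral>\<^sup>+y. (\<integral>\<^sup>+x. q (\<lambda>j\<in>{..<m}. y j - lin m f x j) \<partial>leb m) * g y \<partial>leb m)"
      by (intro nn_integral_cong nn_integral_multc) measurable
    also have "\<dots> = (\<integral>\<^sup>+y. \<kappa> * g y \<partial>leb m)"
    proof (rule nn_integral_cong)
      fix y
      have "(\<integral>\<^sup>+x. q (\<lambda>j\<in>{..<m}. y j - lin m f x j) \<partial>leb m) =
        (\<integral>\<^sup>+x. q (\<lambda>j\<in>{..<m}. y j - (\<lambda>j\<in>{..<m}. y j + lin m f x j) j) \<partial>leb m)"
        by (rule transl[of "\<lambda>z. q (\<lambda>j\<in>{..<m}. y j - z j)" y]) measurable
      also have "\<dots> = \<kappa>" unfolding \<kappa>_def by (simp cong: restrict_cong)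
      finally show "(\<integral>\<^sup>+x. q (\<lambda>j\<in>{..<m}. y j - lin m f x j) \<partial>leb m) * g y = \<kappa> * g y" by simp
    qed
    also have "\<dots> = \<kappa> * (\<integral>\<^sup>+y. g y \<partial>leb m)" by (rule nn_integral_cmult) measurable
    finally show ?thesis .
  qed
  then show ?thesis by blast
qed

section \<open>Frames in triangular position\<close>

definition unitv :: "nat \<Rightarrow> nat \<Rightarrow> real"
  where "unitv j = (\<lambda>l. if l = j then 1 else 0)"

text \<open>
  The functionals are represented by their coefficient vectors, and \<open>a\<close> is the inverse of the
  matrix with rows \<open>f\<close>: it recovers the coordinates of \<open>x\<close> from the values \<open>dot m (f i) x\<close>.
\<close>

definition orthonormal_frame ::
    "((nat \<Rightarrow> real) \<Rightarrow> (nat \<Rightarrow> real) \<Rightarrow> real) \<Rightarrow> nat \<Rightarrow> (nat \<Rightarrow> nat \<Rightarrow> real) \<Rightarrow> (nat \<Rightarrow> nat \<Rightarrow> real) \<Rightarrow> bool"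
  where "orthonormal_frame \<beta> m f a \<longleftrightarrow>
    (\<forall>i<m. \<forall>j<m. \<beta> (f i) (f j) = (if i = j then 1 else 0)) \<and>
    (\<forall>j<m. unitv j = (\<Sum>i<m. a j i *\<^sub>R f i))"

text \<open>Orthonormalization of the unit vectors in their natural order. Positivity is demanded in
  the form \<open>v k = 1\<close> with zeros beyond \<open>k\<close>, because this is the shape of
  the residual left when \<open>unitv k\<close> is projected off its predecessors.\<close>

lemma gram_schmidt:
  fixes \<beta> :: "(nat \<Rightarrow> real) \<Rightarrow> (nat \<Rightarrow> real) \<Rightarrow> real"
  assumes bil: "bilinear \<beta>" and sym: "\<And>v w. \<beta> v w = \<beta> w v"
    and pos: "\<And>k v. k < m \<Longrightarrow> v k = 1 \<Longrightarrow> (\<forall>l>k. v l = 0) \<Longrightarrow> \<beta> v v > 0"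
  shows "\<exists>f a. orthonormal_frame \<beta> m f a"
proof -
  \<comment> \<open>The support condition carried through the induction gives the next residual
    \<open>v\<close> entry 1 at \<open>k\<close> and zeros beyond.\<close>
  have "\<exists>f a. orthonormal_frame \<beta> k f a \<and> (\<forall>i<k. \<forall>l\<ge>k. f i l = 0)" if "k \<le> m" for k
    using that
  proof (induction k)
    case 0
    then show ?case by (simp add: orthonormal_frame_def)
  next
    case (Suc k)
    then obtain f a where on: "\<And>i j. i < k \<Longrightarrow> j < k \<Longrightarrow> \<beta> (f i) (f j) = (if i = j then 1 else 0)"
      and un: "\<And>j. j < k \<Longrightarrow> unitv j = (\<Sum>i<k. a j i *\<^sub>R f i)"
      and z: "\<And>i l. i < k \<Longrightarrow> l \<ge> k \<Longrightarrow> f i l = 0"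
      unfolding orthonormal_frame_def by (metis Suc_leD)
    define p where "p = (\<Sum>i<k. \<beta> (unitv k) (f i) *\<^sub>R f i)"
    define v where "v = unitv k - p"
    have v: "v k = 1" "\<forall>l>k. v l = 0"
      using z by (simp_all add: v_def p_def unitv_def sum_fun_apply)
    then have bv: "\<beta> v v > 0" using pos[of k v] Suc.prems by auto
    define q where "q = sqrt (\<beta> v v)"
    have q: "q > 0" "q * q = \<beta> v v" using bv by (simp_all add: q_def)
    have vf: "\<beta> v (f i) = 0" if "i < k" for i
    proof -
      have "\<beta> p (f i) = (\<Sum>j<k. \<beta> (unitv k) (f j) * \<beta> (f j) (f i))"
      proof -
        have l: "linear (\<lambda>u. \<beta> u (f i))" using bil by (simp add: bilinear_def)
        show ?thesis unfolding p_def by (simp add: linear_sum[OF l] linear_scale[OF l])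
      qed
      also have "\<dots> = (\<Sum>j<k. if j = i then \<beta> (unitv k) (f j) else 0)"
        by (intro sum.cong refl) (use on that in auto)
      also have "\<dots> = \<beta> (unitv k) (f i)" using that by simp
      finally show ?thesis by (simp add: v_def bilinear_lsub[OF bil])
    qed
    define f' where "f' = f(k := (1 / q) *\<^sub>R v)"
    \<comment> \<open>Row \<open>k\<close> expresses \<open>unitv k\<close> as \<open>p\<close> plus
      \<open>q\<close> times the new vector; the earlier rows are extended by zero.\<close>
    define a' where "a' = (\<lambda>j i. if j < k then (if i < k then a j i else 0)
      else (if i < k then \<beta> (unitv k) (f i) else q))"
    have "\<beta> (f' i) (f' j) = (if i = j then 1 else 0)" if "i < Suc k" "j < Suc k" for i j
    proof -
      have "\<beta> (f' k) (f' k) = 1"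
        using q bv by (simp add: f'_def bilinear_lmul[OF bil] bilinear_rmul[OF bil] divide_simps del: scaleR_fun_apply)
      moreover have "\<beta> (f' k) (f' i) = 0" "\<beta> (f' i) (f' k) = 0" if "i < k" for i
        using vf[OF that] sym[of "f i" v] that
        by (simp_all add: f'_def bilinear_lmul[OF bil] bilinear_rmul[OF bil] del: scaleR_fun_apply)
      moreover have "\<beta> (f' i) (f' j) = (if i = j then 1 else 0)" if "i < k" "j < k" for i j
        using on[OF that] that by (simp add: f'_def)
      ultimately show ?thesis using that by (metis less_SucE nat_less_le)
    qed
    moreover have "unitv j = (\<Sum>i<Suc k. a' j i *\<^sub>R f' i)" if "j < Suc k" for j
    proof (cases "j < k")
      case True
      then have "(\<Sum>i<k. a' j i *\<^sub>R f' i) = unitv j"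
        unfolding un[OF True] by (intro sum.cong refl) (auto simp: a'_def f'_def)
      then show ?thesis using True by (simp add: a'_def)
    next
      case False
      then have j: "j = k" using that by simp
      have "(\<Sum>i<k. a' j i *\<^sub>R f' i) = p"
        unfolding p_def j by (intro sum.cong refl) (auto simp: a'_def f'_def)
      moreover have "a' k k *\<^sub>R f' k = v" using q by (simp add: a'_def f'_def)
      ultimately show ?thesis using j by (simp add: v_def)
    qed
    moreover have "f' i l = 0" if "i < Suc k" "l \<ge> Suc k" for i l
      using that z v by (auto simp: f'_def less_Suc_eq)
    ultimately show ?case unfolding orthonormal_frame_def by blast
  qed
  then show ?thesis by blast
qed

lemma dot_diff_scale: "dot m (v - c *\<^sub>R w) x = dot m v x - c * dot m w x"
  by (simp only: dot_simps(2,3))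

text \<open>
  The frame is reflected by a Householder matrix that acts on the indices \<open>\<le> r\<close> and maps the vector
  of values at \<open>x\<close> to a multiple of the last unit vector. When that vector has this form already,
  \<open>W = 0\<close>, and \<open>c = 2 / W = 0\<close> makes the reflection the identity.
\<close>

lemma householder:
  fixes \<beta> :: "(nat \<Rightarrow> real) \<Rightarrow> (nat \<Rightarrow> real) \<Rightarrow> real"
  assumes bil: "bilinear \<beta>" and sym: "\<And>v w. \<beta> v w = \<beta> w v"
    and fr: "orthonormal_frame \<beta> m f a" and r: "r < m"
  obtains f' a' where "orthonormal_frame \<beta> m f' a'"
    and "\<And>i. i < r \<Longrightarrow> dot m (f' i) x = 0"
    and "dot m (f' r) x = sqrt (\<Sum>j\<le>r. (dot m (f j) x)\<^sup>2)"
    and "\<And>i. r < i \<Longrightarrow> f' i = f i"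
    and "\<And>i y. i \<le> r \<Longrightarrow> (\<And>j. j \<le> r \<Longrightarrow> dot m (f j) y = 0) \<Longrightarrow> dot m (f' i) y = 0"
proof -
  have on: "\<And>i j. i < m \<Longrightarrow> j < m \<Longrightarrow> \<beta> (f i) (f j) = (if i = j then 1 else 0)"
    and un: "\<And>j. j < m \<Longrightarrow> unitv j = (\<Sum>i<m. a j i *\<^sub>R f i)"
    using fr by (auto simp: orthonormal_frame_def)
  define v where "v j = dot m (f j) x" for j
  define s where "s = sqrt (\<Sum>j\<le>r. (v j)\<^sup>2)"
  \<comment> \<open>\<open>w\<close> is the vector of values on the indices up to \<open>r\<close>
    minus its target, which has \<open>s\<close> in position \<open>r\<close> and zeros elsewhere.
    Both have length \<open>s\<close>, so the reflection along \<open>w\<close> exchanges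
    them.\<close>
  define w where "w j = (if j < r then v j else if j = r then v r - s else 0)" for j
  define W where "W = (\<Sum>j<m. (w j)\<^sup>2)"
  define c where "c = 2 / W"
  define g where "g = (\<Sum>j<m. w j *\<^sub>R f j)"
  define f' where "f' i = f i - (c * w i) *\<^sub>R g" for i
  have split: "(\<Sum>j<m. h j) = (\<Sum>j<r. h j) + h r" if "\<And>j. j > r \<Longrightarrow> h j = 0" for h :: "nat \<Rightarrow> real"
  proof -
    have "(\<Sum>j<m. h j) = (\<Sum>j<Suc r. h j)"
      using r that by (intro sum.mono_neutral_right) auto
    then show ?thesis by simp
  qed
  have s2: "s\<^sup>2 = (\<Sum>j<r. (v j)\<^sup>2) + (v r)\<^sup>2"
    by (simp add: s_def sum_nonneg lessThan_Suc_atMost[symmetric] add_nonneg_nonneg)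
  have W: "W = 2 * (s\<^sup>2 - s * v r)"
    unfolding W_def by (subst split) (simp_all add: w_def s2, simp add: power2_eq_square s2[unfolded power2_eq_square] algebra_simps)
  have P: "(\<Sum>j<m. w j * v j) = s\<^sup>2 - s * v r"
    by (subst split) (simp_all add: w_def s2, simp add: power2_eq_square algebra_simps)
  have cW: "c * W * w i = 2 * w i" if "i < m" for i
  proof (cases "W = 0")
    case True
    then have "w i = 0" using that by (simp add: W_def sum_nonneg_eq_0_iff)
    then show ?thesis by simp
  qed (simp add: c_def)
  have bgf: "\<beta> g (f i) = w i" if "i < m" for i
  proof -
    have l: "linear (\<lambda>u. \<beta> u (f i))" using bil by (simp add: bilinear_def)
    have "\<beta> g (f i) = (\<Sum>j<m. w j * \<beta> (f j) (f i))"
      unfolding g_def by (simp add: linear_sum[OF l] linear_scale[OF l])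
    also have "\<dots> = (\<Sum>j<m. if j = i then w j else 0)"
      by (intro sum.cong refl) (use on that in auto)
    finally show ?thesis using that by simp
  qed
  have bgg: "\<beta> g g = W"
  proof -
    have l: "linear (\<beta> g)" using bil by (simp add: bilinear_def)
    have "\<beta> g g = (\<Sum>j<m. w j * \<beta> g (f j))"
      by (subst (2) g_def) (simp add: linear_sum[OF l] linear_scale[OF l])
    then show ?thesis using bgf by (simp add: W_def power2_eq_square)
  qed
  have "\<beta> (f' i) (f' j) = (if i = j then 1 else 0)" if ij: "i < m" "j < m" for i j
  proof -
    have "\<beta> (f' i) (f' j) = \<beta> (f i) (f j) - c * w j * \<beta> (f i) g - c * w i * \<beta> g (f j)
        + c * w i * (c * w j) * \<beta> g g"
      unfolding f'_def
      by (simp add: bilinear_lsub[OF bil] bilinear_rsub[OF bil] bilinear_lmul[OF bil] bilinear_rmul[OF bil]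
          algebra_simps del: scaleR_fun_apply)
    also have "\<dots> = \<beta> (f i) (f j) - 2 * c * w j * w i + c * w j * (c * W * w i)"
      using bgf[OF ij(1)] bgf[OF ij(2)] by (simp add: sym[of "f i"] bgg algebra_simps)
    also have "\<dots> = \<beta> (f i) (f j)" unfolding cW[OF ij(1)] by simp
    finally show ?thesis using on ij by simp
  qed
  \<comment> \<open>A reflection is its own inverse, so the new inverse matrix is \<open>a\<close>
    multiplied by the same reflection.\<close>
  moreover have "unitv j = (\<Sum>i<m. (a j i - c * w i * (\<Sum>l<m. a j l * w l)) *\<^sub>R f' i)" if "j < m" for j
  proof (rule ext)
    fix l
    let ?A = "\<Sum>l<m. a j l * w l"
    have gl: "g l = (\<Sum>i<m. w i * f i l)" by (simp add: g_def sum_fun_apply)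
    have "c * W * g l = (\<Sum>i<m. (c * W * w i) * f i l)"
      by (simp add: gl sum_distrib_left mult.assoc)
    also have "\<dots> = 2 * g l" unfolding gl sum_distrib_left by (intro sum.cong) (auto simp: cW)
    finally have cWg: "c * W * g l = 2 * g l" .
    have 1: "(\<Sum>i<m. a j i * f' i l) = unitv j l - c * ?A * g l"
      by (simp add: un[OF that] f'_def sum_fun_apply algebra_simps sum_subtractf sum_distrib_left)
    have "(\<Sum>i<m. w i * f' i l) = g l - c * W * g l"
      by (simp add: f'_def gl W_def algebra_simps sum_subtractf sum_distrib_left sum_distrib_right power2_eq_square)
    then have 2: "(\<Sum>i<m. w i * f' i l) = - g l" using cWg by simp
    have "(\<Sum>i<m. (a j i - c * w i * ?A) * f' i l) =
       (\<Sum>i<m. a j i * f' i l) - c * ?A * (\<Sum>i<m. w i * f' i l)"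
      by (simp only: left_diff_distrib sum_subtractf sum_distrib_left[of "c * ?A"]) (simp add: mult_ac)
    then show "unitv j l = (\<Sum>i<m. (a j i - c * w i * ?A) *\<^sub>R f' i) l"
      by (simp add: sum_fun_apply 1 2)
  qed
  ultimately have H1: "orthonormal_frame \<beta> m f' (\<lambda>j i. a j i - c * w i * (\<Sum>l<m. a j l * w l))"
    unfolding orthonormal_frame_def by blast
  have dg: "dot m g y = (\<Sum>j<m. w j * dot m (f j) y)" for y
    by (simp only: g_def dot_sum dot_simps(3))
  \<comment> \<open>The reflected values are \<open>v - w\<close>: zero below \<open>r\<close> and
    \<open>s\<close> at \<open>r\<close>.\<close>
  have dv: "dot m (f' i) x = v i - w i" if "i < m" for i
  proof -
    have "c * w i * dot m g x = c * w i * (W / 2)" by (simp add: dg v_def[symmetric] P W)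
    also have "\<dots> = w i" using cW[OF that] by (simp add: mult_ac)
    finally show ?thesis by (simp only: f'_def dot_diff_scale v_def)
  qed
  have H2: "dot m (f' i) x = 0" if "i < r" for i
    using dv[of i] r that by (simp add: w_def)
  have H3: "dot m (f' r) x = sqrt (\<Sum>j\<le>r. (dot m (f j) x)\<^sup>2)"
    using dv[of r] r by (simp add: w_def s_def v_def)
  have H4: "f' i = f i" if "r < i" for i
    using that by (simp add: f'_def w_def)
  \<comment> \<open>\<open>w\<close> is supported on the indices up to \<open>r\<close>, so
    \<open>g\<close> combines only functionals that vanish at \<open>y\<close>.\<close>
  have H5: "dot m (f' i) y = 0" if "i \<le> r" "\<And>j. j \<le> r \<Longrightarrow> dot m (f j) y = 0" for i y
  proof -
    have "dot m g y = 0" unfolding dg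
      by (intro sum.neutral) (use that w_def in force)
    then show ?thesis using that by (simp only: f'_def dot_diff_scale)
  qed
  show thesis by (rule that[OF H1 H2 H3 H4 H5])
qed

text \<open>
  The points are chosen from the last index downwards, and each step reflects only the part of the
  frame that vanishes on the points chosen so far.
\<close>

lemma triangular_points:
  fixes \<beta> :: "(nat \<Rightarrow> real) \<Rightarrow> (nat \<Rightarrow> real) \<Rightarrow> real"
  assumes bil: "bilinear \<beta>" and sym: "\<And>v w. \<beta> v w = \<beta> w v"
    and pos: "\<And>k v. k < m \<Longrightarrow> v k = 1 \<Longrightarrow> (\<forall>l>k. v l = 0) \<Longrightarrow> \<beta> v v > 0"
    and avg: "\<And>f a r. orthonormal_frame \<beta> m f a \<Longrightarrow> r < m \<Longrightarrow>
      \<exists>x\<in>L. real (Suc r) \<le> (\<Sum>j\<le>r. (dot m (f j) x)\<^sup>2)"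
  shows "\<exists>f a x. orthonormal_frame \<beta> m f a \<and>
    (\<forall>k<m. x k \<in> L \<and> (\<forall>j<k. dot m (f j) (x k) = 0) \<and> sqrt (real (Suc k)) \<le> dot m (f k) (x k))"
proof -
  let ?P = "\<lambda>n. \<exists>f a x. orthonormal_frame \<beta> m f a \<and>
    (\<forall>k<m. k \<ge> n \<longrightarrow> x k \<in> L \<and> (\<forall>j<k. dot m (f j) (x k) = 0) \<and> sqrt (real (Suc k)) \<le> dot m (f k) (x k))"
  have "?P 0"
  proof (rule inc_induct[of 0 m ?P])
    show "?P m" using gram_schmidt[OF bil sym pos] by auto
  next
    fix n assume n: "n < m" and "?P (Suc n)"
    then obtain f a x where fr: "orthonormal_frame \<beta> m f a"
      and x: "\<And>k. k < m \<Longrightarrow> k > n \<Longrightarrow> x k \<in> L \<and> (\<forall>j<k. dot m (f j) (x k) = 0) \<and> sqrt (real (Suc k)) \<le> dot m (f k) (x k)"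
      by (auto simp: Suc_le_eq)
    \<comment> \<open>The frame here is the outcome of the earlier reflections; for this reason
      \<open>avg\<close> is assumed of every orthonormal frame.\<close>
    obtain z where z: "z \<in> L" "real (Suc n) \<le> (\<Sum>j\<le>n. (dot m (f j) z)\<^sup>2)" using avg[OF fr n] by blast
    obtain f' a' where f': "orthonormal_frame \<beta> m f' a'"
      "\<And>i. i < n \<Longrightarrow> dot m (f' i) z = 0"
      "dot m (f' n) z = sqrt (\<Sum>j\<le>n. (dot m (f j) z)\<^sup>2)"
      "\<And>i. n < i \<Longrightarrow> f' i = f i"
      "\<And>i y. i \<le> n \<Longrightarrow> (\<And>j. j \<le> n \<Longrightarrow> dot m (f j) y = 0) \<Longrightarrow> dot m (f' i) y = 0"
      by (rule householder[OF bil sym fr n, of z]) blast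
    define x' where "x' = x(n := z)"
    have "x' k \<in> L \<and> (\<forall>j<k. dot m (f' j) (x' k) = 0) \<and> sqrt (real (Suc k)) \<le> dot m (f' k) (x' k)"
      if k: "k < m" "k \<ge> n" for k
    proof (cases "k = n")
      case True
      then show ?thesis using z f'(2,3) by (simp add: x'_def)
    next
      case False
      then have kn: "k > n" using k by simp
      \<comment> \<open>The functionals up to \<open>n\<close> were mixed only among themselves and
        all vanish at \<open>x k\<close>; the later ones are unchanged.\<close>
      have "dot m (f' j) (x k) = 0" if "j < k" for j
      proof (cases "j \<le> n")
        case True
        then show ?thesis using f'(5)[OF True] x[OF k(1) kn] kn by simp
      next
        case False
        then show ?thesis using f'(4)[of j] x[OF k(1) kn] that by simp
      qed
      then show ?thesis using x[OF k(1) kn] f'(4)[OF kn] kn by (simp add: x'_def)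
    qed
    then show "?P n" using f'(1) by blast
  qed simp
  then show ?thesis by simp
qed

section \<open>Large parallelepipeds with edges in a set\<close>

definition gauss_const :: real
  where "gauss_const = (LINT y|lborel. exp (- y\<^sup>2))"

lemma nn_integral_gauss: "(\<integral>\<^sup>+y. ennreal (exp (- y\<^sup>2)) \<partial>lborel) = ennreal gauss_const"
  and gauss_const_nonneg: "gauss_const \<ge> 0"
proof -
  have "has_bochner_integral lborel (\<lambda>x. exp (- x\<^sup>2) :: real) (sqrt pi / 2 + sqrt pi / 2)"
  proof -
    have "has_bochner_integral lborel (\<lambda>x. exp (- x\<^sup>2) :: real) (2 *\<^sub>R (sqrt pi / 2))"
      by (rule has_bochner_integral_even_function[OF gaussian_moment_0]) simp
    then show ?thesis by simp
  qed
  then have "integrable lborel (\<lambda>x. exp (- x\<^sup>2) :: real)" by (rule integrable.intros)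
  then show "(\<integral>\<^sup>+y. ennreal (exp (- y\<^sup>2)) \<partial>lborel) = ennreal gauss_const"
    unfolding gauss_const_def by (subst nn_integral_eq_integral) auto
  show "gauss_const \<ge> 0" unfolding gauss_const_def by (rule integral_nonneg_AE) simp
qed

lemma nn_integral_gauss_leb:
  "(\<integral>\<^sup>+y. ennreal (exp (- (\<Sum>j<m. (y j)\<^sup>2))) \<partial>leb m) = ennreal (gauss_const ^ m)"
proof -
  interpret product_sigma_finite "\<lambda>_::nat. lborel :: real measure" ..
  have "(\<integral>\<^sup>+y. ennreal (exp (- (\<Sum>j<m. (y j)\<^sup>2))) \<partial>leb m) =
    (\<integral>\<^sup>+y. (\<Prod>j<m. ennreal (exp (- (y j)\<^sup>2))) \<partial>leb m)"
    by (simp add: prod_ennreal exp_sum[symmetric] sum_negf)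
  also have "\<dots> = (\<Prod>j<m. (\<integral>\<^sup>+y. ennreal (exp (- y\<^sup>2)) \<partial>lborel))"
    by (rule product_nn_integral_prod) auto
  finally show ?thesis by (simp add: nn_integral_gauss ennreal_power gauss_const_nonneg)
qed

text \<open>A single term of the exponential series at \<open>m\<close>.\<close>

lemma power_self_le_exp_fact: "real m ^ m \<le> exp (real m) * fact m"
proof -
  have "(\<Sum>n\<in>{m}. inverse (fact n) *\<^sub>R real m ^ n) \<le> exp (real m)"
    unfolding exp_def by (rule sum_le_suminf[OF summable_exp_generic]) auto
  then show ?thesis by (simp add: field_simps)
qed

text \<open>This is the product of the lower bounds on the diagonal in
  \<open>triangular_points\<close>.\<close>

lemma sqrt_fact: "sqrt (fact m) = (\<Prod>j<m. sqrt (real (Suc j)))"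
  by (induction m) (simp_all add: real_sqrt_mult mult.commute)

lemma dot_right_sum: "dot m v (\<lambda>j. \<Sum>k\<in>A. c k * x k j) = (\<Sum>k\<in>A. c k * dot m v (x k))"
proof -
  have "dot m v (\<lambda>j. \<Sum>k\<in>A. c k * x k j) = (\<Sum>i<m. \<Sum>k\<in>A. c k * (v i * x k i))"
    by (simp add: dot_def sum_distrib_left mult.left_commute)
  also have "\<dots> = (\<Sum>k\<in>A. \<Sum>i<m. c k * (v i * x k i))" by (rule sum.swap)
  finally show ?thesis by (simp add: dot_def sum_distrib_left)
qed

lemma dot_divide_right: "dot m v (\<lambda>j. x j / c) = dot m v x / c"
  by (simp add: dot_def sum_divide_distrib)

lemma dot_unitv: "j < m \<Longrightarrow> dot m (unitv j) x = x j"
  by (simp add: dot_def unitv_def if_distrib[of "\<lambda>x. x * _"] cong: if_cong)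

text \<open>A triangular map of determinant one carries the set to a coordinate hyperplane. The
  shape of \<open>v\<close> is that of a Gram-Schmidt residual, for which the second moments have to
  be positive.\<close>

lemma emeasure_leb_hyperplane:
  assumes k: "k < m" and v: "v k = 1" "\<forall>l>k. v l = 0"
  shows "emeasure (leb m) {t \<in> space (leb m). dot m v t = 0} = 0"
proof -
  interpret product_sigma_finite "\<lambda>_::nat. lborel :: real measure" ..
  \<comment> \<open>The identity matrix with row \<open>k\<close> replaced by \<open>v\<close>; it
    is lower triangular because \<open>v\<close> vanishes beyond \<open>k\<close>, and its diagonal
    is 1 because \<open>v k = 1\<close>.\<close>
  define c where "c j i = (if j = k then v i else if i = j then 1 else 0)" for j i :: nat
  let ?A = "{t \<in> space (leb m). t k = 0}"
  have A: "?A \<in> sets (leb m)"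
    by (rule borel_measurable_eq[OF measurable_leb_coord[OF k] borel_measurable_const])
  have "?A = (\<Pi>\<^sub>E j\<in>{..<m}. if j = k then {0::real} else UNIV)"
  proof (intro set_eqI iffI)
    fix t assume t: "t \<in> (\<Pi>\<^sub>E j\<in>{..<m}. if j = k then {0::real} else UNIV)"
    have "t k \<in> (if k = k then {0::real} else UNIV)" by (rule PiE_mem[OF t]) (use k in simp)
    moreover have "t \<in> extensional {..<m}" using t by (simp add: PiE_def)
    ultimately show "t \<in> ?A" by (simp add: space_PiM PiE_def)
  next
    fix t assume "t \<in> ?A"
    then show "t \<in> (\<Pi>\<^sub>E j\<in>{..<m}. if j = k then {0::real} else UNIV)" by (simp add: space_PiM PiE_def)
  qed
  then have "emeasure (leb m) ?A = (\<Prod>j<m. emeasure lborel (if j = k then {0} else UNIV :: real set))"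
    by (simp only:) (rule emeasure_PiM, auto)
  also have "\<dots> = 0" using k by (intro prod_zero) (auto intro!: bexI[of _ k])
  finally have 0: "emeasure (leb m) ?A = 0" .
  have low: "lower m (\<lambda>_. 0) c t k = dot m v t" for t
  proof -
    have "dot m v t = (\<Sum>i\<le>k. v i * t i)"
      unfolding dot_def using k v by (intro sum.mono_neutral_right) auto
    then show ?thesis using k by (simp add: lower_def c_def)
  qed
  have "ennreal (\<Prod>j<m. \<bar>c j j\<bar>) * (\<integral>\<^sup>+t. indicator ?A (lower m (\<lambda>_. 0) c t) \<partial>leb m) =
      (\<integral>\<^sup>+t. indicator ?A t \<partial>leb m)"
    by (rule nn_integral_lower[OF borel_measurable_indicator[OF A]]) (use v in \<open>auto simp: c_def\<close>)
  moreover have "(\<Prod>j<m. \<bar>c j j\<bar>) = 1" by (rule prod.neutral) (use v in \<open>auto simp: c_def\<close>)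
  ultimately have "(\<integral>\<^sup>+t. indicator ?A (lower m (\<lambda>_. 0) c t) \<partial>leb m) = 0" using 0 A by simp
  moreover have "(\<integral>\<^sup>+t. indicator ?A (lower m (\<lambda>_. 0) c t) \<partial>leb m) =
    (\<integral>\<^sup>+t. indicator {t \<in> space (leb m). dot m v t = 0} t \<partial>leb m)"
    using measurable_space[OF measurable_lower]
    by (intro nn_integral_cong) (auto simp: indicator_def low)
  ultimately show ?thesis by simp
qed

section \<open>Second moments over a bounded set of positive measure\<close>

locale bounded_positive_set =
  fixes m :: nat and L :: "(nat \<Rightarrow> real) set" and R :: real
  assumes L_sets [measurable]: "L \<in> sets (leb m)"
    and L_bounded: "\<And>t j. t \<in> L \<Longrightarrow> j < m \<Longrightarrow> \<bar>t j\<bar> \<le> R"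
    and L_pos: "emeasure (leb m) L > 0"
begin

lemma L_finite: "emeasure (leb m) L < \<infinity>"
proof -
  \<comment> \<open>The absolute value covers \<open>m = 0\<close>, where the sign of
    \<open>R\<close> is unconstrained; the endpoints are written in the form of
    \<open>emeasure_leb_cube\<close>.\<close>
  define B where "B = (\<Pi>\<^sub>E j\<in>{..<m}. {-\<bar>R\<bar>..-\<bar>R\<bar> + 2 * \<bar>R\<bar>})"
  have "B \<in> sets (leb m)" unfolding B_def by (rule sets_PiM_I_finite) simp_all
  moreover have "L \<subseteq> B"
  proof
    fix t assume t: "t \<in> L"
    have "t \<in> space (leb m)" using sets.sets_into_space[OF L_sets] t by blast
    moreover have "t j \<in> {-\<bar>R\<bar>..-\<bar>R\<bar> + 2 * \<bar>R\<bar>}" if "j < m" for j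
      using L_bounded[OF t that] by (simp only: atLeastAtMost_iff) linarith
    ultimately show "t \<in> B" unfolding B_def space_PiM PiE_iff by blast
  qed
  ultimately have "emeasure (leb m) L \<le> emeasure (leb m) B" by (simp only: emeasure_mono)
  also have "\<dots> = ennreal ((2 * \<bar>R\<bar>) ^ m)" unfolding B_def by (rule emeasure_leb_cube) simp
  also have "\<dots> < \<infinity>" by (rule ennreal_less_top[folded infinity_ennreal_def])
  finally show ?thesis .
qed

lemma emeasure_L: "emeasure (leb m) L = ennreal (measure (leb m) L)"
  by (rule emeasure_eq_ennreal_measure) (use L_finite in \<open>simp only: infinity_ennreal_def less_top\<close>)

lemma mL_pos: "measure (leb m) L > 0"
  using L_pos unfolding emeasure_L by (simp only: ennreal_less_zero_iff)

definition avg :: "((nat \<Rightarrow> real) \<Rightarrow> real) \<Rightarrow> real"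
  where "avg h = (LINT t|leb m. indicator L t * h t) / measure (leb m) L"

lemma dot_bounded: "t \<in> L \<Longrightarrow> \<bar>dot m v t\<bar> \<le> (\<Sum>i<m. \<bar>v i\<bar>) * R"
  unfolding dot_def sum_distrib_right
proof (rule order_trans[OF sum_abs sum_mono])
  fix i assume "t \<in> L" "i \<in> {..<m}"
  then have "\<bar>t i\<bar> \<le> R" using L_bounded[of t i] by simp
  then show "\<bar>v i * t i\<bar> \<le> \<bar>v i\<bar> * R" unfolding abs_mult by (rule mult_left_mono) simp
qed

lemma integrable_L:
  fixes h :: "(nat \<Rightarrow> real) \<Rightarrow> real"
  assumes "h \<in> borel_measurable (leb m)" "\<And>t. t \<in> L \<Longrightarrow> \<bar>h t\<bar> \<le> B"
  shows "integrable (leb m) (\<lambda>t. indicator L t * h t)"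
proof -
  have "integrable (leb m) (\<lambda>t. indicator L t *\<^sub>R h t)"
  proof (rule integrableI_bounded_set_indicator[OF L_sets assms(1) L_finite])
    show "AE t in leb m. t \<in> L \<longrightarrow> norm (h t) \<le> B" using assms(2) by simp
  qed
  then show ?thesis by simp
qed

lemma integrable_dot: "integrable (leb m) (\<lambda>t. indicator L t * (dot m v t * dot m w t))"
proof -
  have bound: "\<bar>dot m v t * dot m w t\<bar> \<le> ((\<Sum>i<m. \<bar>v i\<bar>) * R) * ((\<Sum>i<m. \<bar>w i\<bar>) * R)"
    if "t \<in> L" for t
    unfolding abs_mult
    by (rule mult_mono[OF dot_bounded[OF that] dot_bounded[OF that]
          order_trans[OF abs_ge_zero dot_bounded[OF that]] abs_ge_zero])
  show ?thesis
    by (rule integrable_L[OF borel_measurable_times[OF measurable_dot measurable_dot] bound])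
qed

text \<open>The inner product of linear functionals in the L2 space of the uniform distribution on
  \<open>L\<close>. In an orthonormal frame the uncentred second moments of \<open>L\<close> form
  the identity matrix.\<close>

definition form :: "(nat \<Rightarrow> real) \<Rightarrow> (nat \<Rightarrow> real) \<Rightarrow> real"
  where "form v w = avg (\<lambda>t. dot m v t * dot m w t)"

lemma form_sym: "form v w = form w v"
  by (simp add: form_def mult.commute)

lemma form_bilinear: "bilinear form"
proof -
  have "form (v + v') w = form v w + form v' w" "form (c *\<^sub>R v) w = c * form v w" for c v v' w
  proof -
    have "(LINT t|leb m. indicator L t * (dot m (v + v') t * dot m w t)) =
      (LINT t|leb m. indicator L t * (dot m v t * dot m w t) + indicator L t * (dot m v' t * dot m w t))"
      by (intro Bochner_Integration.integral_cong refl) (simp only: dot_simps(1), simp add: algebra_simps)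
    then show "form (v + v') w = form v w + form v' w"
      by (simp add: form_def avg_def integrable_dot add_divide_distrib)
    have "(LINT t|leb m. indicator L t * (dot m (c *\<^sub>R v) t * dot m w t)) =
      (LINT t|leb m. c * (indicator L t * (dot m v t * dot m w t)))"
      by (intro Bochner_Integration.integral_cong refl) (simp only: dot_simps(3), simp add: algebra_simps)
    then show "form (c *\<^sub>R v) w = c * form v w"
      by (simp add: form_def avg_def)
  qed
  note l = this
  have "linear (\<lambda>v. form v w)" for w by (rule linearI) (use l in auto)
  moreover have "linear (form v)" for v
    by (rule linearI) (simp_all only: form_sym[of v] l real_scaleR_def)
  ultimately show ?thesis by (simp add: bilinear_def)
qed

text \<open>A nonnegative integrand with integral zero vanishes almost everywhere. As
  \<open>h\<close> is almost nowhere zero, \<open>L\<close> would then be a null set.\<close>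

lemma positive_integral:
  fixes h :: "(nat \<Rightarrow> real) \<Rightarrow> real"
  assumes "integrable (leb m) (\<lambda>t. indicator L t * h t)" "\<And>t. t \<in> L \<Longrightarrow> h t \<ge> 0"
    and "emeasure (leb m) {t \<in> space (leb m). h t = 0} = 0" "h \<in> borel_measurable (leb m)"
  shows "(LINT t|leb m. indicator L t * h t) > 0"
proof (rule ccontr)
  assume neg: "\<not> ?thesis"
  have nn: "0 \<le> indicator L t * h t" for t using assms(2)[of t] by (cases "t \<in> L") auto
  have "(LINT t|leb m. indicator L t * h t) = 0"
  proof -
    have "0 \<le> (LINT t|leb m. indicator L t * h t)" by (rule integral_nonneg_AE) (simp only: nn, simp)
    then show ?thesis using neg by simp
  qed
  then have "AE t in leb m. indicator L t * h t = 0"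
    using integral_nonneg_eq_0_iff_AE[OF assms(1)] nn by simp
  moreover have "AE t in leb m. h t \<noteq> 0"
    using assms(3,4) by (subst AE_iff_measurable[OF _ refl]) auto
  ultimately have "AE t in leb m. t \<notin> L" by eventually_elim (auto simp: indicator_def)
  moreover have "L = {t \<in> space (leb m). \<not> t \<notin> L}" using sets.sets_into_space[OF L_sets] by blast
  ultimately have "emeasure (leb m) L = 0" using AE_iff_measurable[OF L_sets, of "\<lambda>t. t \<notin> L"] by simp
  then show False using L_pos by simp
qed

lemma form_pos:
  assumes "k < m" "v k = 1" "\<forall>l>k. v l = 0"
  shows "form v v > 0"
proof -
  have "(LINT t|leb m. indicator L t * (dot m v t * dot m v t)) > 0"
    using emeasure_leb_hyperplane[OF assms] integrable_dot by (intro positive_integral) auto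
  then show ?thesis using mL_pos by (simp add: form_def avg_def)
qed

lemma integral_sum_squares:
  assumes "orthonormal_frame form m f a" "r \<le> m"
  shows "(LINT t|leb m. indicator L t * (\<Sum>j<r. (dot m (f j) t)\<^sup>2)) = real r * measure (leb m) L"
    "integrable (leb m) (\<lambda>t. indicator L t * (\<Sum>j<r. (dot m (f j) t)\<^sup>2))"
proof -
  have "(LINT t|leb m. indicator L t * (dot m (f j) t * dot m (f j) t)) = measure (leb m) L" if "j < r" for j
  proof -
    have "form (f j) (f j) = 1" using assms that by (simp add: orthonormal_frame_def)
    then show ?thesis using mL_pos by (simp add: form_def avg_def)
  qed
  then have "(\<Sum>j<r. LINT t|leb m. indicator L t * (dot m (f j) t * dot m (f j) t)) = real r * measure (leb m) L"
    by simp
  moreover have eq: "(\<lambda>t. indicator L t * (\<Sum>j<r. (dot m (f j) t)\<^sup>2)) =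
      (\<lambda>t. \<Sum>j<r. indicator L t * (dot m (f j) t * dot m (f j) t))"
    unfolding sum_distrib_left power2_eq_square ..
  ultimately show "(LINT t|leb m. indicator L t * (\<Sum>j<r. (dot m (f j) t)\<^sup>2)) = real r * measure (leb m) L"
    by (simp only: eq Bochner_Integration.integral_sum[OF integrable_dot])
  show "integrable (leb m) (\<lambda>t. indicator L t * (\<Sum>j<r. (dot m (f j) t)\<^sup>2))"
    unfolding eq by (intro Bochner_Integration.integrable_sum integrable_dot)
qed

lemma integral_const: "(LINT t|leb m. indicator L t * (c::real)) = c * measure (leb m) L"
    "integrable (leb m) (\<lambda>t. indicator L t * (c::real))"
  using L_finite by (simp_all add: mult.commute)

text \<open>The mean of the sum over \<open>L\<close> is \<open>Suc r\<close>. If the sum stayed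
  below this value on all of \<open>L\<close>, the difference would have a strictly positive
  integral, which is in fact zero.\<close>

lemma large_point:
  assumes fr: "orthonormal_frame form m f a" and r: "r < m"
  shows "\<exists>x\<in>L. real (Suc r) \<le> (\<Sum>j\<le>r. (dot m (f j) x)\<^sup>2)"
proof (rule ccontr)
  assume neg: "\<not> ?thesis"
  define s where "s t = (\<Sum>j<Suc r. (dot m (f j) t)\<^sup>2)" for t
  have lt: "s t < real (Suc r)" if "t \<in> L" for t
    using neg that unfolding s_def lessThan_Suc_atMost by (meson not_le)
  have [measurable]: "s \<in> borel_measurable (leb m)" unfolding s_def by measurable
  have si: "(LINT t|leb m. indicator L t * s t) = real (Suc r) * measure (leb m) L"
    "integrable (leb m) (\<lambda>t. indicator L t * s t)"
    unfolding s_def using integral_sum_squares[OF fr, of "Suc r"] r by auto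
  \<comment> \<open>The value 1 outside \<open>L\<close> keeps \<open>h\<close> away from zero
    everywhere, so the null set in \<open>positive_integral\<close> is empty.\<close>
  define h where "h t = (if t \<in> L then real (Suc r) - s t else 1)" for t
  have eq: "indicator L t * h t = indicator L t * real (Suc r) - indicator L t * s t" for t
    by (auto simp: h_def indicator_def)
  have "(LINT t|leb m. indicator L t * h t) > 0"
  proof (rule positive_integral)
    show "integrable (leb m) (\<lambda>t. indicator L t * h t)"
      unfolding eq by (intro Bochner_Integration.integrable_diff integral_const(2) si(2))
    show "h t \<ge> 0" if "t \<in> L" for t unfolding h_def using lt[OF that] by simp
    have "h t \<noteq> 0" for t using lt[of t] by (cases "t \<in> L") (simp_all add: h_def)
    then have "{t \<in> space (leb m). h t = 0} = {}" by blast
    then show "emeasure (leb m) {t \<in> space (leb m). h t = 0} = 0" by (simp only: emeasure_empty)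
    show "h \<in> borel_measurable (leb m)" unfolding h_def by measurable
  qed
  moreover have "(LINT t|leb m. indicator L t * h t) = 0"
    unfolding eq Bochner_Integration.integral_diff[OF integral_const(2)[of "real (Suc r)"] si(2)]
    by (simp only: si(1) integral_const(1))
  ultimately show False by simp
qed

text \<open>
  Jensen's inequality, through the tangent of \<open>exp\<close> at the mean \<open>m\<close> of the sum of squares.
\<close>

lemma gauss_lower_bound:
  assumes fr: "orthonormal_frame form m f a"
  shows "ennreal (exp (- real m)) * emeasure (leb m) L
    \<le> (\<integral>\<^sup>+x. ennreal (exp (- (\<Sum>j<m. (dot m (f j) x)\<^sup>2))) \<partial>leb m)"
proof -
  define s where "s t = (\<Sum>j<m. (dot m (f j) t)\<^sup>2)" for t
  have [measurable]: "s \<in> borel_measurable (leb m)" unfolding s_def by measurable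
  have si: "(LINT t|leb m. indicator L t * s t) = real m * measure (leb m) L"
    "integrable (leb m) (\<lambda>t. indicator L t * s t)"
    unfolding s_def using integral_sum_squares[OF fr, of m] by auto
  have ie: "integrable (leb m) (\<lambda>t. indicator L t * exp (- s t))"
    by (rule integrable_L[of _ 1]) (auto simp: s_def sum_nonneg)
  let ?l = "\<lambda>t. exp (- real m) * (indicator L t * (1 + real m) - indicator L t * s t)"
  have il: "integrable (leb m) ?l"
    by (intro integrable_mult_right Bochner_Integration.integrable_diff integral_const(2) si(2))
  have "exp (- real m) * measure (leb m) L = (LINT t|leb m. ?l t)"
    unfolding integral_mult_right_zero Bochner_Integration.integral_diff[OF integral_const(2)[of "1 + real m"] si(2)]
    by (simp only: si(1) integral_const(1)) (simp add: algebra_simps)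
  also have "\<dots> \<le> (LINT t|leb m. indicator L t * exp (- s t))"
  proof (rule integral_mono[OF il ie])
    fix t
    have "1 + (real m - s t) \<le> exp (real m - s t)" by (rule exp_ge_add_one_self)
    then have "exp (- real m) * (1 + (real m - s t)) \<le> exp (- real m) * exp (real m - s t)"
      by (intro mult_left_mono) auto
    then show "?l t \<le> indicator L t * exp (- s t)"
      by (auto simp: indicator_def exp_add[symmetric] algebra_simps)
  qed
  finally have "ennreal (exp (- real m) * measure (leb m) L) \<le> ennreal (LINT t|leb m. indicator L t * exp (- s t))"
    by (rule ennreal_leI)
  also have "\<dots> = (\<integral>\<^sup>+t. ennreal (indicator L t * exp (- s t)) \<partial>leb m)"
    by (rule nn_integral_eq_integral[symmetric, OF ie]) auto
  also have "\<dots> \<le> (\<integral>\<^sup>+t. ennreal (exp (- s t)) \<partial>leb m)"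
    by (intro nn_integral_mono) (auto simp: indicator_def)
  finally show ?thesis by (simp add: s_def emeasure_L ennreal_mult)
qed

text \<open>In frame coordinates the Gaussian bounds \<open>L\<close> by
  \<open>(exp 1 * gauss_const) ^ m\<close>, and a parallelepiped with edges \<open>x k / m\<close>
  has volume at least \<open>p\<close>. Since \<open>1 / p\<close> is at most
  \<open>(exp 1 * sqrt m) ^ m\<close>, two factors \<open>exp 1\<close> per dimension make up the
  constant.\<close>

lemma large_parallelepiped:
  assumes m: "m \<ge> 1"
  shows "\<exists>x. (\<forall>k<m. x k \<in> L) \<and> (\<forall>S\<in>sets (leb m). \<forall>s.
    (\<forall>c. (\<forall>k<m. 0 \<le> c k \<and> c k \<le> 1) \<longrightarrow> (\<lambda>j\<in>{..<m}. s j + (\<Sum>k<m. c k * x k j) / real m) \<in> S) \<longrightarrow>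
    emeasure (leb m) L \<le> ennreal ((exp 2 * gauss_const * sqrt (real m)) ^ m) * emeasure (leb m) S)"
proof -
  have "\<exists>f a x. orthonormal_frame form m f a \<and>
    (\<forall>k<m. x k \<in> L \<and> (\<forall>j<k. dot m (f j) (x k) = 0) \<and> sqrt (real (Suc k)) \<le> dot m (f k) (x k))"
    by (rule triangular_points[OF form_bilinear form_sym]) (use form_pos large_point in blast)+
  then obtain f a x where fr: "orthonormal_frame form m f a"
    and X: "\<forall>k<m. x k \<in> L \<and> (\<forall>j<k. dot m (f j) (x k) = 0) \<and> sqrt (real (Suc k)) \<le> dot m (f k) (x k)"
    by (elim exE conjE)
  have x: "\<And>k. k < m \<Longrightarrow> x k \<in> L" "\<And>j k. k < m \<Longrightarrow> j < k \<Longrightarrow> dot m (f j) (x k) = 0"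
      "\<And>k. k < m \<Longrightarrow> sqrt (real (Suc k)) \<le> dot m (f k) (x k)"
    using X by simp_all
  have xpos: "dot m (f k) (x k) > 0" if "k < m" for k
    using x(3)[OF that] by (rule less_le_trans[rotated]) simp
  have tri: "dot m (f j) (\<lambda>i. \<Sum>k<m. t k * x k i) = (\<Sum>k\<le>j. dot m (f j) (x k) * t k)" if "j < m" for t j
  proof -
    have "(\<Sum>k<m. t k * dot m (f j) (x k)) = (\<Sum>k\<le>j. t k * dot m (f j) (x k))"
      using x(2) that by (intro sum.mono_neutral_right) auto
    then show ?thesis by (simp add: dot_right_sum mult.commute)
  qed
  \<comment> \<open>The values of the functionals at the points form an invertible triangular
    matrix, so a combination of the points attains any prescribed values.\<close>
  have surj: "\<exists>x. \<forall>j<m. dot m (f j) x = y j" for y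
  proof -
    obtain t where "\<forall>j<m. 0 + (\<Sum>k\<le>j. dot m (f j) (x k) * t k) = y j"
      using lower_surj[of m "\<lambda>j k. dot m (f j) (x k)" "\<lambda>_. 0" y] xpos by force
    then show ?thesis using tri by (intro exI[of _ "\<lambda>i. \<Sum>k<m. t k * x k i"]) auto
  qed
  \<comment> \<open>The Jacobian factor of the frame coordinates; it enters the estimates of
    \<open>L\<close> and of \<open>S\<close> alike and cancels.\<close>
  obtain \<kappa> where \<kappa>: "\<And>g. g \<in> borel_measurable (leb m) \<Longrightarrow>
      (\<integral>\<^sup>+x. g (lin m f x) \<partial>leb m) = \<kappa> * (\<integral>\<^sup>+y. g y \<partial>leb m)"
    using nn_integral_lin[of m f] surj by blast
  have "(\<integral>\<^sup>+x. ennreal (exp (- (\<Sum>j<m. (dot m (f j) x)\<^sup>2))) \<partial>leb m) =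
     (\<integral>\<^sup>+x. ennreal (exp (- (\<Sum>j<m. (lin m f x j)\<^sup>2))) \<partial>leb m)"
    by (simp add: lin_def)
  also have "\<dots> = \<kappa> * ennreal (gauss_const ^ m)"
    unfolding nn_integral_gauss_leb[symmetric] by (rule \<kappa>) measurable
  finally have Lk: "ennreal (exp (- real m)) * emeasure (leb m) L \<le> \<kappa> * ennreal (gauss_const ^ m)"
    using gauss_lower_bound[OF fr] by simp
  \<comment> \<open>The inverse of \<open>lin m f\<close>, which lets the measure of
    \<open>S\<close> be computed in frame coordinates.\<close>
  define A where "A y = (\<lambda>j\<in>{..<m}. \<Sum>i<m. a j i * y i)" for y
  have [measurable]: "A \<in> leb m \<rightarrow>\<^sub>M leb m"
    unfolding A_def by (intro measurable_leb_restrict borel_measurable_sum borel_measurable_times) auto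
  have A: "A (\<lambda>j\<in>{..<m}. dot m (f j) z) = restrict z {..<m}" for z
  proof -
    have "(\<Sum>i<m. a j i * dot m (f i) z) = z j" if "j < m" for j
    proof -
      have "unitv j = (\<Sum>i<m. a j i *\<^sub>R f i)" using fr that by (simp add: orthonormal_frame_def)
      then have "dot m (unitv j) z = (\<Sum>i<m. a j i * dot m (f i) z)" by (simp only: dot_sum dot_simps(3))
      then show ?thesis using dot_unitv[OF that] by simp
    qed
    then show ?thesis by (auto simp: A_def fun_eq_iff)
  qed
  define p where "p = sqrt (fact m) / real m ^ m"
  have p: "p > 0" using m by (simp add: p_def)
  have "emeasure (leb m) L \<le> ennreal ((exp 2 * gauss_const * sqrt (real m)) ^ m) * emeasure (leb m) S"
    if S[measurable]: "S \<in> sets (leb m)"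
      and box: "\<And>c. (\<forall>k<m. 0 \<le> c k \<and> c k \<le> 1) \<Longrightarrow> (\<lambda>j\<in>{..<m}. s j + (\<Sum>k<m. c k * x k j) / real m) \<in> S"
    for S s
  proof -
    have "emeasure (leb m) S = (\<integral>\<^sup>+z. indicator S (A (lin m f z)) \<partial>leb m)"
    proof -
      have "A (lin m f z) = z" if "z \<in> space (leb m)" for z
        using that A[of z] by (auto simp: lin_def space_PiM PiE_iff extensional_restrict)
      then have "(\<integral>\<^sup>+z. indicator S (A (lin m f z)) \<partial>leb m) = (\<integral>\<^sup>+z. indicator S z \<partial>leb m)"
        by (intro nn_integral_cong) simp
      then show ?thesis by simp
    qed
    also have "\<dots> = \<kappa> * (\<integral>\<^sup>+y. indicator S (A y) \<partial>leb m)" by (rule \<kappa>) measurable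
    finally have Sk: "emeasure (leb m) S = \<kappa> * (\<integral>\<^sup>+y. indicator S (A y) \<partial>leb m)" .
    define b where "b j = dot m (f j) s" for j
    \<comment> \<open>Column \<open>k\<close> holds the frame coordinates of the edge
      \<open>x k / m\<close>. The zeros of \<open>f j\<close> at \<open>x k\<close> for
      \<open>j < k\<close> make the matrix lower triangular.\<close>
    define c where "c j k = dot m (f j) (x k) / real m" for j k
    have cpos: "c j j > 0" if "j < m" for j using xpos[OF that] m by (simp add: c_def)
    define Q where "Q = (\<Pi>\<^sub>E j\<in>{..<m}. {0..1::real})"
    have [measurable]: "Q \<in> sets (leb m)" unfolding Q_def by (intro sets_PiM_I_finite) auto
    \<comment> \<open>The unit cube parametrizes the parallelepiped through \<open>lower\<close>,
      and \<open>box\<close> places its image in \<open>S\<close>.\<close>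
    have "1 = (\<integral>\<^sup>+t. indicator Q t \<partial>leb m)"
      using emeasure_leb_cube[of 1 m 0] by (simp add: Q_def[symmetric])
    also have "\<dots> \<le> (\<integral>\<^sup>+t. indicator S (A (lower m b c t)) \<partial>leb m)"
    proof (rule nn_integral_mono)
      fix t
      have "A (lower m b c t) \<in> S" if t: "t \<in> Q"
      proof -
        let ?z = "\<lambda>i. s i + (\<Sum>k<m. t k * x k i) / real m"
        have "dot m (f j) ?z = b j + (\<Sum>k\<le>j. c j k * t k)" if "j < m" for j
        proof -
          have "dot m (f j) ?z = b j + (\<Sum>k\<le>j. dot m (f j) (x k) * t k) / real m"
            by (simp only: dot_add_right dot_divide_right tri[OF that] b_def)
          then show ?thesis by (simp add: c_def sum_divide_distrib)
        qed
        then have "lower m b c t = (\<lambda>j\<in>{..<m}. dot m (f j) ?z)"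
          by (auto simp: lower_def fun_eq_iff)
        then have "A (lower m b c t) = restrict ?z {..<m}" by (simp only: A)
        then show ?thesis using box[of t] t by (auto simp: Q_def PiE_iff)
      qed
      then show "indicator Q t \<le> (indicator S (A (lower m b c t)) :: ennreal)"
        by (auto simp: indicator_def)
    qed
    finally have one: "1 \<le> (\<integral>\<^sup>+t. indicator S (A (lower m b c t)) \<partial>leb m)" .
    have "p = (\<Prod>j<m. sqrt (real (Suc j)) / real m)"
      unfolding p_def prod_dividef sqrt_fact by simp
    also have "\<dots> \<le> (\<Prod>j<m. \<bar>c j j\<bar>)"
    proof (intro prod_mono conjI)
      fix j assume j: "j \<in> {..<m}"
      then have "sqrt (real (Suc j)) / real m \<le> c j j" unfolding c_def using x(3)[of j] by (intro divide_right_mono) auto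
      then show "sqrt (real (Suc j)) / real m \<le> \<bar>c j j\<bar>" by linarith
    qed simp
    finally have "ennreal p \<le> ennreal (\<Prod>j<m. \<bar>c j j\<bar>) * 1" by (simp add: ennreal_leI)
    also have "\<dots> \<le> ennreal (\<Prod>j<m. \<bar>c j j\<bar>) * (\<integral>\<^sup>+t. indicator S (A (lower m b c t)) \<partial>leb m)"
      by (rule mult_left_mono[OF one]) simp
    also have "\<dots> = (\<integral>\<^sup>+y. indicator S (A y) \<partial>leb m)"
      by (rule nn_integral_lower) (use cpos in \<open>force+\<close>)
    finally have pS: "\<kappa> * ennreal p \<le> emeasure (leb m) S" unfolding Sk by (rule mult_left_mono) simp
    have G: "gauss_const ^ m \<ge> 0" using gauss_const_nonneg by simp
    have "emeasure (leb m) L = ennreal (exp (real m)) * (ennreal (exp (- real m)) * emeasure (leb m) L)"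
      by (simp add: mult.assoc[symmetric] ennreal_mult[symmetric] exp_minus_inverse)
    also have "\<dots> \<le> ennreal (exp (real m)) * (\<kappa> * ennreal (gauss_const ^ m))"
      by (rule mult_left_mono[OF Lk]) simp
    also have "\<dots> = ennreal (exp (real m) * gauss_const ^ m / p) * (\<kappa> * ennreal p)"
    proof -
      have "ennreal (exp (real m) * gauss_const ^ m / p) * ennreal p = ennreal (exp (real m)) * ennreal (gauss_const ^ m)"
        using p G by (simp add: ennreal_mult[symmetric])
      then show ?thesis by (simp add: mult_ac)
    qed
    also have "\<dots> \<le> ennreal (exp (real m) * gauss_const ^ m / p) * emeasure (leb m) S"
      by (rule mult_left_mono[OF pS]) simp
    also have "\<dots> \<le> ennreal ((exp 2 * gauss_const * sqrt (real m)) ^ m) * emeasure (leb m) S"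
    proof (intro mult_right_mono ennreal_leI)
      \<comment> \<open>One of the two roots of \<open>m ^ m\<close> is traded for
        \<open>exp m * sqrt (fact m)\<close>, with \<open>sqrt (exp m)\<close> bounded by
        \<open>exp m\<close>; the other gives \<open>sqrt m ^ m\<close>.\<close>
      have "sqrt (real m ^ m) * sqrt (real m ^ m) \<le> sqrt (real m ^ m) * sqrt (exp (real m) * fact m)"
        using power_self_le_exp_fact[of m] by (intro mult_left_mono) auto
      also have "\<dots> \<le> sqrt (real m ^ m) * (exp (real m) * sqrt (fact m))"
        by (auto intro!: mult_left_mono mult_right_mono real_le_lsqrt simp: real_sqrt_mult power2_eq_square exp_add[symmetric])
      finally have le: "sqrt (real m ^ m) * sqrt (real m ^ m) \<le> sqrt (real m ^ m) * (exp (real m) * sqrt (fact m))" .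
      have "sqrt (real m ^ m) * sqrt (real m ^ m) = real m ^ m" by simp
      with le have "1 / p \<le> exp (real m) * sqrt (real m) ^ m"
        unfolding p_def real_sqrt_power by (simp add: divide_le_eq mult_ac)
      then have "exp (real m) * gauss_const ^ m * (1 / p) \<le> exp (real m) * gauss_const ^ m * (exp (real m) * sqrt (real m) ^ m)"
        using G by (intro mult_left_mono) auto
      also have "\<dots> = (exp 2 * gauss_const * sqrt (real m)) ^ m"
        by (simp add: power_mult_distrib exp_of_nat_mult[symmetric] exp_add[symmetric] mult_ac)
      finally show "exp (real m) * gauss_const ^ m / p \<le> (exp 2 * gauss_const * sqrt (real m)) ^ m" by simp
    qed simp
    finally show ?thesis .
  qed
  then show ?thesis using x(1) by blast
qed

end

section \<open>Sections of a convex body\<close>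

lemma measurable_lincomb [measurable]:
  fixes u :: "nat \<Rightarrow> nat \<Rightarrow> real"
  shows "(\<lambda>t. \<Sum>j<m. t j *\<^sub>R u j) \<in> leb m \<rightarrow>\<^sub>M borel"
proof (rule measurable_coordinatewise_then_product)
  fix i show "(\<lambda>t. (\<Sum>j<m. t j *\<^sub>R u j) i) \<in> borel_measurable (leb m)"
    by (simp add: sum_fun_apply)
qed

lemma measurable_fun_add [measurable]:
  fixes f g :: "'a \<Rightarrow> nat \<Rightarrow> real"
  assumes "f \<in> M \<rightarrow>\<^sub>M borel" "g \<in> M \<rightarrow>\<^sub>M borel"
  shows "(\<lambda>x. f x + g x) \<in> M \<rightarrow>\<^sub>M borel"
proof (rule measurable_coordinatewise_then_product)
  fix i
  have "(\<lambda>x. f x i) \<in> borel_measurable M" "(\<lambda>x. g x i) \<in> borel_measurable M"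
    using assms[THEN measurable_compose, OF measurable_product_coordinates] .
  then show "(\<lambda>x. (f x + g x) i) \<in> borel_measurable M" by simp
qed

text \<open>Passes from an extensional point of \<open>leb n\<close> to the vector of
  \<open>Rn n\<close> with the same first \<open>n\<close> coordinates.\<close>

definition pad :: "nat \<Rightarrow> (nat \<Rightarrow> real) \<Rightarrow> nat \<Rightarrow> real"
  where "pad n z = (\<lambda>i. if i < n then z i else 0)"

lemma measurable_pad [measurable]: "pad n \<in> leb n \<rightarrow>\<^sub>M borel"
proof (rule measurable_coordinatewise_then_product)
  fix i show "(\<lambda>z. pad n z i) \<in> borel_measurable (leb n)"
    by (cases "i < n") (simp_all add: pad_def)
qed

text \<open>The topology of \<open>Euclidean_space n\<close> is induced by the product topology,
  which is the topology of the function type.\<close>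

lemma compactin_Euclidean_space_imp_compact:
  assumes "compactin (Euclidean_space n) K"
  shows "compact K" "K \<subseteq> Rn n"
proof -
  show "K \<subseteq> Rn n" using assms by (rule compactin_subset_topspace)
  show "compact K"
    using assms unfolding Euclidean_space_def compactin_subtopology euclidean_product_topology by simp
qed

lemma continuous_on_coord: "continuous_on A (\<lambda>x. (x::nat \<Rightarrow> real) i)"
  by (rule continuous_on_subset[OF continuous_on_product_coordinates]) simp

lemma compact_difference_body:
  assumes "compact K"
  shows "compact (difference_body K)"
proof -
  have "continuous_on (K \<times> K) (\<lambda>p. fst p - snd p)"
  proof (rule continuous_on_coordinatewise_then_product)
    fix i
    have "continuous_on (K \<times> K) (\<lambda>p. fst p i - snd p i)"
      by (intro continuous_on_diff continuous_on_compose2[OF continuous_on_coord[of UNIV]] continuous_intros) auto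
    then show "continuous_on (K \<times> K) (\<lambda>p. (fst p - snd p) i)" by simp
  qed
  then have "compact ((\<lambda>p. fst p - snd p) ` (K \<times> K))"
    using assms by (intro compact_continuous_image compact_Times)
  moreover have "(\<lambda>p. fst p - snd p) ` (K \<times> K) = difference_body K"
    by (force simp: difference_body_def image_def)
  ultimately show ?thesis by simp
qed

lemma compact_coord_bounded:
  fixes K :: "(nat \<Rightarrow> real) set"
  assumes "compact K" "continuous_on K f"
  shows "\<exists>B::real. \<forall>z\<in>K. \<bar>f z\<bar> \<le> B"
  using compact_imp_bounded[OF compact_continuous_image[OF assms(2,1)]] by (auto simp: bounded_iff)

section \<open>Orthonormal coordinates on the subspace and its translates\<close>

locale body_section =
  fixes m n :: nat and K F :: "(nat \<Rightarrow> real) set"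
  assumes m: "1 \<le> m" and mn: "m \<le> n" and body: "convex_body n K"
    and sub: "subspace F" and FR: "F \<subseteq> Rn n" and dimF: "dim F = m"
begin

text \<open>The same choice as in \<open>flat_lborel\<close>, so that \<open>emb\<close> is the
  isometry from which that measure is built.\<close>

definition u :: "nat \<Rightarrow> nat \<Rightarrow> real"
  where "u = (SOME u. orthonormal_basis n F u)"

definition emb :: "(nat \<Rightarrow> real) \<Rightarrow> nat \<Rightarrow> real"
  where "emb t = (\<Sum>j<m. t j *\<^sub>R u j)"

lemma u: "orthonormal_basis n F u"
  unfolding u_def using orthonormal_basis_exists[OF sub FR] by (rule someI_ex)

lemma u_on: "i < m \<Longrightarrow> j < m \<Longrightarrow> dot n (u i) (u j) = (if i = j then 1 else 0)"
  and u_span: "span (u ` {..<m}) = F"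
  using u by (simp_all add: orthonormal_basis_def dimF)

lemma emb_in_F: "emb t \<in> F"
proof -
  have "emb t \<in> span (u ` {..<m})"
    unfolding emb_def by (intro span_sum span_scale span_base) auto
  then show ?thesis by (simp only: u_span)
qed

lemma dot_emb: "j < m \<Longrightarrow> dot n (emb t) (u j) = t j"
proof -
  assume j: "j < m"
  have "dot n (emb t) (u j) = (\<Sum>i<m. t i * dot n (u i) (u j))"
    by (simp only: emb_def dot_sum dot_simps(3))
  also have "\<dots> = (\<Sum>i<m. if i = j then t i else 0)"
    by (intro sum.cong refl) (use u_on j in auto)
  finally show ?thesis using j by simp
qed

text \<open>\<open>F\<close> is the fixed set of its orthogonal projection. This turns membership
  into equations between coordinates.\<close>

lemma F_iff: "y \<in> F \<longleftrightarrow> y = emb (\<lambda>j. dot n y (u j))"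
proof
  assume "y \<in> F"
  then have "y \<in> span (u ` {..<m})" by (simp add: u_span)
  then have "\<exists>t. y = emb t"
  proof (induction rule: span_induct_alt)
    case base
    show ?case by (rule exI[of _ "\<lambda>_. 0"]) (simp add: emb_def)
  next
    case (step c x y)
    then obtain i t where i: "i < m" "x = u i" and t: "y = emb t" by auto
    have "(\<Sum>j<m. (if j = i then c else 0) *\<^sub>R u j) = (\<Sum>j<m. if j = i then c *\<^sub>R u j else 0)"
      by (intro sum.cong refl) simp
    also have "\<dots> = c *\<^sub>R x" using i by simp
    finally have "c *\<^sub>R x + y = emb (\<lambda>j. (if j = i then c else 0) + t j)"
      unfolding t emb_def by (simp only: scaleR_add_left sum.distrib)
    then show ?case by blast
  qed
  then obtain t where t: "y = emb t" by blast
  have "emb (\<lambda>j. dot n y (u j)) = emb t"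
    unfolding emb_def[of "\<lambda>j. dot n y (u j)"] emb_def[of t]
    by (intro sum.cong refl) (simp only: t dot_emb lessThan_iff)
  from t this[symmetric] show "y = emb (\<lambda>j. dot n y (u j))" by (rule trans)
next
  assume "y = emb (\<lambda>j. dot n y (u j))"
  then show "y \<in> F" by (rule ssubst) (rule emb_in_F)
qed

lemma emb_add: "emb (\<lambda>j. s j + t j) = emb s + emb t"
  by (simp add: emb_def scaleR_add_left sum.distrib)

lemma emb_scale: "emb (\<lambda>j. c * t j) = c *\<^sub>R emb t"
  by (simp add: emb_def scaleR_sum_right del: scaleR_fun_apply)

lemma emb_sum: "emb (\<lambda>j. \<Sum>k\<in>A. t k j) = (\<Sum>k\<in>A. emb (t k))"
  by (induction A rule: infinite_finite_induct) (simp_all add: emb_add, simp_all add: emb_def)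

lemma emb_restrict [simp]: "emb (restrict t {..<m}) = emb t"
  by (simp add: emb_def)

lemma measurable_emb [measurable]: "emb \<in> leb m \<rightarrow>\<^sub>M borel"
  unfolding emb_def[abs_def] by (rule measurable_lincomb)

lemma cK: "compact K" and KR: "K \<subseteq> Rn n" and convK: "convex K"
  using body compactin_Euclidean_space_imp_compact by (auto simp: convex_body_def)

lemma K_borel [measurable]: "K \<in> sets borel"
  using cK by (intro borel_closed compact_imp_closed)

lemma dK_borel [measurable]: "difference_body K \<in> sets borel"
  using compact_difference_body[OF cK] by (intro borel_closed compact_imp_closed)

lemma translate_borel: "(\<lambda>y. y + x) ` F \<in> sets borel"
proof (rule borel_closed)
  \<comment> \<open>\<open>z - x\<close> equals its own projection. Each equation involves finitely
    many coordinates, so it defines a closed set.\<close>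
  have eq: "(\<lambda>y. y + x) ` F = {z. \<forall>i. z i - x i = (\<Sum>j<m. (\<Sum>k<n. (z k - x k) * u j k) * u j i)}"
  proof -
    have "(\<lambda>y. y + x) ` F = {z. z - x \<in> F}"
    proof (intro set_eqI iffI)
      fix z assume "z \<in> {z. z - x \<in> F}"
      then show "z \<in> (\<lambda>y. y + x) ` F" by (intro image_eqI[of z _ "z - x"]) simp_all
    qed auto
    also have "\<dots> = {z. \<forall>i. z i - x i = (\<Sum>j<m. (\<Sum>k<n. (z k - x k) * u j k) * u j i)}"
      unfolding F_iff by (simp add: fun_eq_iff emb_def sum_fun_apply dot_def)
    finally show ?thesis .
  qed
  show "closed ((\<lambda>y. y + x) ` F)"
    unfolding eq
  proof (rule closed_Collect_all)
    fix i
    show "closed {z. z i - x i = (\<Sum>j<m. (\<Sum>k<n. (z k - x k) * u j k) * u j i)}"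
      by (rule closed_Collect_eq)
        (intro continuous_on_sum continuous_on_mult continuous_on_diff continuous_on_coord continuous_on_const)+
  qed
qed

section \<open>Sections of the body and of its difference body in coordinates\<close>

definition sect :: "(nat \<Rightarrow> real) \<Rightarrow> (nat \<Rightarrow> real) set"
  where "sect x = {t \<in> space (leb m). x + emb t \<in> K}"

definition dsect :: "(nat \<Rightarrow> real) set"
  where "dsect = {t \<in> space (leb m). emb t \<in> difference_body K}"

lemma measurable_shift_emb: "(\<lambda>t. x + emb t) \<in> leb m \<rightarrow>\<^sub>M borel"
  by (rule measurable_fun_add[OF measurable_const measurable_emb]) simp

lemma sect_sets [measurable]: "sect x \<in> sets (leb m)"
proof -
  have "sect x = (\<lambda>t. x + emb t) -` K \<inter> space (leb m)" unfolding sect_def by blast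
  then show ?thesis using measurable_sets[OF measurable_shift_emb K_borel, of x] by (simp only:)
qed

lemma dsect_sets [measurable]: "dsect \<in> sets (leb m)"
proof -
  have "dsect = emb -` difference_body K \<inter> space (leb m)" unfolding dsect_def by blast
  then show ?thesis using measurable_sets[OF measurable_emb dK_borel] by (simp only:)
qed

lemma flat_lborel_eq: "flat_lborel n F x = distr (leb m) borel (\<lambda>t. x + emb t)"
  unfolding flat_lborel_def Let_def dimF emb_def u_def ..

lemma emeasure_flat_sect: "emeasure (flat_lborel n F x) (K \<inter> (\<lambda>y. y + x) ` F) = emeasure (leb m) (sect x)"
proof -
  have B: "K \<inter> (\<lambda>y. y + x) ` F \<in> sets borel" by (intro sets.Int K_borel translate_borel)
  have "x + emb t \<in> (\<lambda>y. y + x) ` F" for t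
    using emb_in_F[of t] by (simp add: add.commute[of x])
  then have "(\<lambda>t. x + emb t) -` (K \<inter> (\<lambda>y. y + x) ` F) \<inter> space (leb m) = sect x"
    unfolding sect_def by blast
  then show ?thesis unfolding flat_lborel_eq emeasure_distr[OF measurable_shift_emb B] by (rule arg_cong)
qed

lemma emeasure_flat_dsect: "emeasure (flat_lborel n F 0) (difference_body K \<inter> F) = emeasure (leb m) dsect"
proof -
  have "F \<in> sets borel" using translate_borel[of 0] by simp
  then have B: "difference_body K \<inter> F \<in> sets borel" by (rule sets.Int[OF dK_borel])
  have "(\<lambda>t. 0 + emb t) -` (difference_body K \<inter> F) \<inter> space (leb m) = dsect"
    unfolding dsect_def using emb_in_F by (simp only: add_0) blast
  then show ?thesis unfolding flat_lborel_eq emeasure_distr[OF measurable_shift_emb B] by (rule arg_cong)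
qed

text \<open>A coordinate is an inner product with some \<open>u j\<close>, which is continuous on
  the compact difference body.\<close>

lemma dsect_bounded: "\<exists>R. \<forall>t\<in>dsect. \<forall>j<m. \<bar>t j\<bar> \<le> R"
proof -
  have "\<exists>B::real. \<forall>z\<in>difference_body K. \<bar>dot n z (u j)\<bar> \<le> B" for j
    unfolding dot_def
    by (rule compact_coord_bounded[OF compact_difference_body[OF cK]])
      (intro continuous_on_sum continuous_on_mult continuous_on_coord continuous_on_const)
  then obtain B where B: "\<And>j z. z \<in> difference_body K \<Longrightarrow> \<bar>dot n z (u j)\<bar> \<le> B j" by metis
  have "\<bar>t j\<bar> \<le> (\<Sum>j<m. \<bar>B j\<bar>)" if "t \<in> dsect" "j < m" for t j
  proof -
    have "\<bar>t j\<bar> \<le> \<bar>B j\<bar>" using B[of "emb t" j] that by (simp add: dsect_def dot_emb)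
    also have "\<dots> \<le> (\<Sum>j<m. \<bar>B j\<bar>)" using that by (intro member_le_sum) auto
    finally show ?thesis .
  qed
  then show ?thesis by blast
qed

definition sup_sect :: ennreal
  where "sup_sect = (SUP x\<in>Rn n. emeasure (leb m) (sect x))"

lemma sect_le_sup: "x \<in> K \<Longrightarrow> emeasure (leb m) (sect x) \<le> sup_sect"
  unfolding sup_sect_def using KR by (intro SUP_upper) auto

text \<open>Each \<open>x k\<close> is the direction of a segment in \<open>K\<close> from
  \<open>b k\<close> to \<open>a k\<close>. Moving along the segments independently and averaging
  stays in \<open>K\<close> and displaces the mean by \<open>c k * x k / m\<close> for each
  \<open>k\<close>.\<close>

lemma sqrt_bound:
  "emeasure (leb m) dsect \<le> ennreal ((exp 2 * gauss_const * sqrt (real m)) ^ m) * sup_sect"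
proof (cases "emeasure (leb m) dsect = 0")
  case False
  obtain R where R: "\<forall>t\<in>dsect. \<forall>j<m. \<bar>t j\<bar> \<le> R" using dsect_bounded by blast
  interpret bounded_positive_set m dsect R
    using R False by unfold_locales (auto simp: zero_less_iff_neq_zero)
  obtain x where x: "\<And>k. k < m \<Longrightarrow> x k \<in> dsect"
    and par: "\<And>S s. S \<in> sets (leb m) \<Longrightarrow>
      (\<And>c. (\<forall>k<m. 0 \<le> c k \<and> c k \<le> 1) \<Longrightarrow> (\<lambda>j\<in>{..<m}. s j + (\<Sum>k<m. c k * x k j) / real m) \<in> S) \<Longrightarrow>
      emeasure (leb m) dsect \<le> ennreal ((exp 2 * gauss_const * sqrt (real m)) ^ m) * emeasure (leb m) S"
    using large_parallelepiped[OF m] by blast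
  have "\<exists>a b. a \<in> K \<and> b \<in> K \<and> emb (x k) = a - b" if "k < m" for k
    using x[OF that] by (auto simp: dsect_def difference_body_def)
  then obtain a b where ab: "\<And>k. k < m \<Longrightarrow> a k \<in> K" "\<And>k. k < m \<Longrightarrow> b k \<in> K"
      "\<And>k. k < m \<Longrightarrow> emb (x k) = a k - b k" by metis
  \<comment> \<open>The mean of the starting points, through which the large section passes.\<close>
  define p where "p = (\<Sum>k<m. (1 / real m) *\<^sub>R b k)"
  have in_K: "p + emb (\<lambda>j\<in>{..<m}. 0 + (\<Sum>k<m. c k * x k j) / real m) \<in> K"
    if c: "\<forall>k<m. 0 \<le> c k \<and> c k \<le> 1" for c
  proof -
    have "emb (\<lambda>j. (\<Sum>k<m. c k * x k j) / real m) = (1 / real m) *\<^sub>R (\<Sum>k<m. c k *\<^sub>R emb (x k))"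
      using emb_scale[of "1 / real m" "\<lambda>j. \<Sum>k<m. c k * x k j"] by (simp add: emb_sum emb_scale)
    also have "\<dots> = (\<Sum>k<m. (1 / real m) *\<^sub>R c k *\<^sub>R (a k - b k))"
      unfolding scaleR_sum_right by (intro sum.cong refl) (use ab in auto)
    finally have "p + emb (\<lambda>j\<in>{..<m}. 0 + (\<Sum>k<m. c k * x k j) / real m) =
      (\<Sum>k<m. (1 / real m) *\<^sub>R ((1 - c k) *\<^sub>R b k + c k *\<^sub>R a k))"
      by (simp add: p_def sum.distrib[symmetric] del: scaleR_fun_apply)
         (intro sum.cong refl, simp add: algebra_simps del: scaleR_fun_apply)
    also have "\<dots> \<in> K"
    proof (rule convex_sum[OF _ convK])
      show "(1 - c k) *\<^sub>R b k + c k *\<^sub>R a k \<in> K" if "k \<in> {..<m}" for k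
        using that c ab by (intro convexD[OF convK]) auto
    qed (use m in auto)
    finally show ?thesis .
  qed
  have "p \<in> K" using in_K[of "\<lambda>_. 0"] by (simp add: emb_def)
  have "emeasure (leb m) dsect \<le> ennreal ((exp 2 * gauss_const * sqrt (real m)) ^ m) * emeasure (leb m) (sect p)"
  proof (rule par[OF sect_sets, of "\<lambda>_. 0"])
    fix c :: "nat \<Rightarrow> real" assume "\<forall>k<m. 0 \<le> c k \<and> c k \<le> 1"
    then show "(\<lambda>j\<in>{..<m}. 0 + (\<Sum>k<m. c k * x k j) / real m) \<in> sect p"
      using in_K by (simp add: sect_def space_PiM del: emb_restrict)
  qed
  also have "\<dots> \<le> ennreal ((exp 2 * gauss_const * sqrt (real m)) ^ m) * sup_sect"
    by (rule mult_left_mono[OF sect_le_sup[OF \<open>p \<in> K\<close>]]) simp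
  finally show ?thesis .
qed simp

section \<open>Volume of the body and averaging over translates\<close>

definition Kn :: "(nat \<Rightarrow> real) set"
  where "Kn = {z \<in> space (leb n). pad n z \<in> K}"

lemma Kn_sets [measurable]: "Kn \<in> sets (leb n)"
proof -
  have "Kn = pad n -` K \<inter> space (leb n)" unfolding Kn_def by blast
  then show ?thesis using measurable_sets[OF measurable_pad K_borel] by (simp only:)
qed

text \<open>A basic product neighbourhood of an interior point contains a box in the first
  \<open>n\<close> coordinates.\<close>

lemma Kn_positive: "emeasure (leb n) Kn > 0"
proof -
  interpret product_sigma_finite "\<lambda>_::nat. lborel :: real measure" ..
  obtain p where p: "p \<in> Euclidean_space n interior_of K" using body by (auto simp: convex_body_def)
  have "openin (Euclidean_space n) (Euclidean_space n interior_of K)" by simp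
  then obtain T where T: "openin (powertop_real UNIV) T" "Euclidean_space n interior_of K = T \<inter> {x. \<forall>i\<ge>n. x i = 0}"
    unfolding Euclidean_space_def openin_subtopology by blast
  have pT: "p \<in> T" "\<And>i. i \<ge> n \<Longrightarrow> p i = 0" using p T(2) by auto
  obtain U where U: "\<And>i. open (U i)" "p \<in> PiE UNIV U" "PiE UNIV U \<subseteq> T"
    using T(1) pT(1) unfolding openin_product_topology_alt by fastforce
  have pU: "p i \<in> U i" for i using U(2) by (simp add: PiE_iff)
  have "\<exists>e>0. cball (p i) e \<subseteq> U i" for i using U(1) pU open_contains_cball by blast
  then obtain e where e: "\<And>i. e i > 0" "\<And>i. cball (p i) (e i) \<subseteq> U i" by metis
  define B where "B = (\<Pi>\<^sub>E i\<in>{..<n}. {p i - e i..p i + e i})"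
  have "emeasure (leb n) B = (\<Prod>i<n. emeasure lborel {p i - e i..p i + e i})"
    unfolding B_def by (rule emeasure_PiM) simp_all
  also have "\<dots> = (\<Prod>i<n. ennreal (2 * e i))"
    using e(1) by (intro prod.cong refl) (simp add: less_imp_le)
  also have "\<dots> = ennreal (\<Prod>i<n. 2 * e i)" using e(1) by (intro prod_ennreal) (simp add: less_imp_le)
  also have "\<dots> > 0" using e(1) by (simp add: prod_pos)
  finally have "0 < emeasure (leb n) B" .
  also have "\<dots> \<le> emeasure (leb n) Kn"
  proof (rule emeasure_mono[OF _ Kn_sets], rule subsetI)
    fix z assume z: "z \<in> B"
    have "pad n z i \<in> U i" for i
    proof (cases "i < n")
      case True
      then have "z i \<in> {p i - e i..p i + e i}" using z by (simp add: B_def PiE_iff)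
      then have "z i \<in> cball (p i) (e i)" by (simp add: dist_real_def abs_le_iff)
      then have "z i \<in> U i" by (rule subsetD[OF e(2)])
      then show ?thesis using True by (simp add: pad_def)
    next
      case False
      \<comment> \<open>Beyond \<open>n\<close> the interior point is zero itself, so the padding
        stays in the neighbourhood.\<close>
      then show ?thesis using pU[of i] pT(2)[of i] by (simp add: pad_def)
    qed
    then have "pad n z \<in> T" using U(3) by (auto simp: PiE_iff)
    then have "pad n z \<in> K" using T(2) interior_of_subset[of "Euclidean_space n" K] by (auto simp: pad_def)
    then show "z \<in> Kn" using z by (simp add: Kn_def B_def space_PiM PiE_def)
  qed
  finally show ?thesis .
qed

lemma Kn_finite: "emeasure (leb n) Kn < \<infinity>"
proof -
  have "\<exists>B::real. \<forall>z\<in>K. \<bar>z j\<bar> \<le> B" for j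
    by (rule compact_coord_bounded[OF cK continuous_on_coord])
  then obtain B where B: "\<And>j z. z \<in> K \<Longrightarrow> \<bar>z j\<bar> \<le> B j" by metis
  have bnd: "\<bar>t j\<bar> \<le> (\<Sum>j<n. \<bar>B j\<bar>)" if "t \<in> Kn" "j < n" for t j
  proof -
    have "\<bar>t j\<bar> \<le> \<bar>B j\<bar>" using B[of "pad n t" j] that by (simp add: Kn_def pad_def)
    also have "\<dots> \<le> (\<Sum>j<n. \<bar>B j\<bar>)" using that by (intro member_le_sum) auto
    finally show ?thesis .
  qed
  \<comment> \<open>The locale is instantiated with the body itself to obtain its finite
    volume.\<close>
  interpret bounded_positive_set n Kn "\<Sum>j<n. \<bar>B j\<bar>"
    by unfold_locales (fact Kn_sets, fact bnd, fact Kn_positive)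
  show ?thesis by (rule L_finite)
qed

lemma pad_restrict_add: "pad n (\<lambda>j\<in>{..<n}. b j + c * z j) = pad n b + c *\<^sub>R pad n z"
  by (auto simp: pad_def fun_eq_iff)

lemma pad_Rn: "x \<in> Rn n \<Longrightarrow> pad n x = x"
  by (auto simp: pad_def fun_eq_iff topspace_Euclidean_space)

text \<open>
  Both sides bound \<open>\<integral>\<^sub>F vol (K \<inter> (K - t)) dt\<close>: if \<open>t = \<theta> (a - b)\<close> with \<open>a, b \<in> K\<close>, then
  \<open>K \<inter> (K - t)\<close> contains \<open>(1 - \<theta>) K + \<theta> b\<close>.
\<close>

lemma dsect_scaled_bound:
  assumes \<theta>: "0 < \<theta>" "\<theta> < 1"
  shows "ennreal (\<theta> ^ m * (1 - \<theta>) ^ n) * emeasure (leb m) dsect \<le> sup_sect"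
proof -
  interpret M: sigma_finite_measure "leb m" by (rule sigma_finite_leb)
  interpret N: sigma_finite_measure "leb n" by (rule sigma_finite_leb)
  interpret P: pair_sigma_finite "leb n" "leb m" ..
  define V where "V = emeasure (leb n) Kn"
  \<comment> \<open>Integrated over \<open>z\<close>, this gives \<open>h t\<close>, the volume of
    \<open>K\<close> intersected with its translate by \<open>- emb t\<close>.\<close>
  define g :: "(nat \<Rightarrow> real) \<Rightarrow> (nat \<Rightarrow> real) \<Rightarrow> ennreal"
    where "g t z = indicator K (pad n z) * indicator K (pad n z + emb t)" for t z
  have mK: "(indicator K :: _ \<Rightarrow> ennreal) \<in> borel_measurable borel"
    by (rule borel_measurable_indicator[OF K_borel])
  have pm: "(\<lambda>(z, t). g t z) \<in> borel_measurable (leb n \<Otimes>\<^sub>M leb m)"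
    unfolding g_def case_prod_beta'
    by (intro borel_measurable_times_ennreal measurable_compose[OF _ mK] measurable_fun_add
        measurable_compose[OF measurable_fst measurable_pad] measurable_compose[OF measurable_snd measurable_emb])
  define h where "h t = (\<integral>\<^sup>+z. g t z \<partial>leb n)" for t
  have mh: "h \<in> borel_measurable (leb m)"
    unfolding h_def using N.borel_measurable_nn_integral[of "\<lambda>t z. g t z" "leb m"]
      measurable_pair_swap[OF pm] by (simp add: case_prod_beta')
  have gm: "g t \<in> borel_measurable (leb n)" for t
    unfolding g_def by (intro borel_measurable_times_ennreal measurable_compose[OF _ mK] measurable_fun_add
        measurable_pad measurable_const) simp
  have "(\<integral>\<^sup>+t. h t \<partial>leb m) = (\<integral>\<^sup>+z. (\<integral>\<^sup>+t. g t z \<partial>leb m) \<partial>leb n)"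
    unfolding h_def by (rule P.Fubini'[OF pm])
  \<comment> \<open>For fixed \<open>z\<close> in the body the admissible \<open>t\<close> fill the
    section through \<open>z\<close>; other \<open>z\<close> contribute nothing.\<close>
  also have "\<dots> \<le> (\<integral>\<^sup>+z. sup_sect * indicator Kn z \<partial>leb n)"
  proof (rule nn_integral_mono)
    fix z assume z: "z \<in> space (leb n)"
    show "(\<integral>\<^sup>+t. g t z \<partial>leb m) \<le> sup_sect * indicator Kn z"
    proof (cases "pad n z \<in> K")
      case True
      have "(\<integral>\<^sup>+t. g t z \<partial>leb m) = (\<integral>\<^sup>+t. indicator (sect (pad n z)) t \<partial>leb m)"
        using True by (intro nn_integral_cong) (simp add: g_def sect_def indicator_def)
      also have "\<dots> = emeasure (leb m) (sect (pad n z))" by (rule nn_integral_indicator[OF sect_sets])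
      finally show ?thesis using sect_le_sup[OF True] True z by (simp add: Kn_def)
    next
      case False
      then show ?thesis by (simp add: g_def)
    qed
  qed
  also have "\<dots> = sup_sect * V" unfolding V_def by (rule nn_integral_cmult_indicator[OF Kn_sets])
  finally have upper: "(\<integral>\<^sup>+t. h t \<partial>leb m) \<le> sup_sect * V" .
  \<comment> \<open>The summand 0 is the translation part in \<open>nn_integral_leb_scale\<close>,
    by which \<open>\<theta> * t\<close> is later replaced by \<open>t\<close>.\<close>
  have lower_h: "ennreal ((1 - \<theta>) ^ n) * V \<le> h (\<lambda>j\<in>{..<m}. 0 + \<theta> * t j)" if t: "t \<in> dsect" for t
  proof -
    obtain a b where ab: "a \<in> K" "b \<in> K" "emb t = a - b" using t by (auto simp: dsect_def difference_body_def)
    have et: "emb (\<lambda>j\<in>{..<m}. 0 + \<theta> * t j) = \<theta> *\<^sub>R a - \<theta> *\<^sub>R b"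
      unfolding emb_restrict add_0 emb_scale ab(3) by (rule scaleR_diff_right)
    have "V = (\<integral>\<^sup>+z. indicator Kn z \<partial>leb n)" unfolding V_def by (rule nn_integral_indicator[OF Kn_sets, symmetric])
    \<comment> \<open>The homothety with centre \<open>b\<close> and ratio
      \<open>1 - \<theta>\<close> maps \<open>K\<close> into the set on which the integrand is 1;
      rescaling \<open>z\<close> then yields the factor \<open>(1 - \<theta>) ^ n\<close>.\<close>
    also have "\<dots> \<le> (\<integral>\<^sup>+z. g (\<lambda>j\<in>{..<m}. 0 + \<theta> * t j) (\<lambda>j\<in>{..<n}. \<theta> * b j + (1 - \<theta>) * z j) \<partial>leb n)"
    proof (rule nn_integral_mono)
      fix z
      show "indicator Kn z \<le> g (\<lambda>j\<in>{..<m}. 0 + \<theta> * t j) (\<lambda>j\<in>{..<n}. \<theta> * b j + (1 - \<theta>) * z j)"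
      proof (cases "z \<in> Kn")
        case True
        then have z: "pad n z \<in> K" by (simp add: Kn_def)
        have "pad n (\<lambda>j. \<theta> * b j) = \<theta> *\<^sub>R pad n b" by (auto simp: pad_def fun_eq_iff)
        also have "pad n b = b" using ab(2) KR by (intro pad_Rn) auto
        finally have eq: "pad n (\<lambda>j\<in>{..<n}. \<theta> * b j + (1 - \<theta>) * z j) = \<theta> *\<^sub>R b + (1 - \<theta>) *\<^sub>R pad n z"
          by (simp only: pad_restrict_add)
        have 1: "\<theta> *\<^sub>R b + (1 - \<theta>) *\<^sub>R pad n z \<in> K"
          using \<theta> by (intro convexD[OF convK ab(2) z]) auto
        have "\<theta> *\<^sub>R a + (1 - \<theta>) *\<^sub>R pad n z \<in> K"
          using \<theta> by (intro convexD[OF convK ab(1) z]) auto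
        moreover have "\<theta> *\<^sub>R b + (1 - \<theta>) *\<^sub>R pad n z + (\<theta> *\<^sub>R a - \<theta> *\<^sub>R b) = \<theta> *\<^sub>R a + (1 - \<theta>) *\<^sub>R pad n z"
          by (simp del: scaleR_fun_apply)
        ultimately have 2: "\<theta> *\<^sub>R b + (1 - \<theta>) *\<^sub>R pad n z + (\<theta> *\<^sub>R a - \<theta> *\<^sub>R b) \<in> K"
          by (simp only:)
        show ?thesis unfolding g_def eq et indicator_simps(1)[OF 1] indicator_simps(1)[OF 2]
          by (simp add: indicator_def)
      qed simp
    qed
    finally have "ennreal ((1 - \<theta>) ^ n) * V \<le> ennreal ((1 - \<theta>) ^ n) *
      (\<integral>\<^sup>+z. g (\<lambda>j\<in>{..<m}. 0 + \<theta> * t j) (\<lambda>j\<in>{..<n}. \<theta> * b j + (1 - \<theta>) * z j) \<partial>leb n)"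
      by (rule mult_left_mono) simp
    also have "\<dots> = h (\<lambda>j\<in>{..<m}. 0 + \<theta> * t j)"
      unfolding h_def by (rule nn_integral_leb_scale[OF gm]) (use \<theta> in simp)
    finally show ?thesis .
  qed
  have "ennreal ((1 - \<theta>) ^ n) * V * emeasure (leb m) dsect =
      (\<integral>\<^sup>+t. ennreal ((1 - \<theta>) ^ n) * V * indicator dsect t \<partial>leb m)"
    by (rule nn_integral_cmult_indicator[OF dsect_sets, symmetric])
  also have "\<dots> \<le> (\<integral>\<^sup>+t. h (\<lambda>j\<in>{..<m}. 0 + \<theta> * t j) \<partial>leb m)"
  proof (rule nn_integral_mono)
    fix t show "ennreal ((1 - \<theta>) ^ n) * V * indicator dsect t \<le> h (\<lambda>j\<in>{..<m}. 0 + \<theta> * t j)"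
      using lower_h[of t] by (cases "t \<in> dsect") simp_all
  qed
  finally have "ennreal (\<theta> ^ m) * (ennreal ((1 - \<theta>) ^ n) * V * emeasure (leb m) dsect) \<le>
      ennreal (\<theta> ^ m) * (\<integral>\<^sup>+t. h (\<lambda>j\<in>{..<m}. 0 + \<theta> * t j) \<partial>leb m)"
    by (rule mult_left_mono) simp
  also have "\<dots> = (\<integral>\<^sup>+t. h t \<partial>leb m)" by (rule nn_integral_leb_scale[OF mh \<theta>(1)])
  also note upper
  finally have le: "V * (ennreal (\<theta> ^ m * (1 - \<theta>) ^ n) * emeasure (leb m) dsect) \<le> V * sup_sect"
    using \<theta> by (simp add: ennreal_mult mult_ac)
  \<comment> \<open>The volume of the body is positive and finite, so it cancels from both
    sides.\<close>
  have "V \<noteq> 0" "V < top" using Kn_positive Kn_finite by (simp_all add: V_def)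
  then show ?thesis using le by (simp add: ennreal_mult_le_mult_iff)
qed

lemma ratio_bound:
  "emeasure (leb m) dsect \<le> ennreal ((2 * exp 1 * (real n / real m)) ^ m) * sup_sect"
proof -
  \<comment> \<open>With this choice \<open>(1 / \<theta>) ^ m\<close> is
    \<open>(2 * n / m) ^ m\<close>, while \<open>(1 - \<theta>) ^ n\<close> costs at most
    \<open>exp (2 * \<theta> * n) = exp m\<close>. The hypothesis \<open>m \<le> n\<close> gives
    \<open>\<theta> \<le> 1 / 2\<close>, needed for the exponential estimate.\<close>
  define \<theta> where "\<theta> = real m / (2 * real n)"
  have \<theta>: "0 < \<theta>" "\<theta> \<le> 1 / 2" using m mn by (simp_all add: \<theta>_def field_simps)
  have "1 / (1 - \<theta>) \<le> exp (2 * \<theta>)"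
  proof -
    have "1 / (1 - \<theta>) = 1 + \<theta> / (1 - \<theta>)" using \<theta> by (simp add: field_simps)
    also have "\<theta> / (1 - \<theta>) \<le> 2 * \<theta>" using \<theta> by (simp add: field_simps)
    also have "1 + 2 * \<theta> \<le> exp (2 * \<theta>)" by (rule exp_ge_add_one_self)
    finally show ?thesis by simp
  qed
  then have "(1 / (1 - \<theta>)) ^ n \<le> exp (2 * \<theta>) ^ n" using \<theta> by (intro power_mono) auto
  also have "exp (2 * \<theta>) ^ n = exp 1 ^ m"
    using m mn by (simp add: exp_of_nat_mult[symmetric] \<theta>_def)
  finally have "(1 / \<theta>) ^ m * (1 / (1 - \<theta>)) ^ n \<le> (1 / \<theta>) ^ m * exp 1 ^ m"
    using \<theta> by (intro mult_left_mono) auto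
  also have "\<dots> = (2 * exp 1 * (real n / real m)) ^ m"
    by (simp add: \<theta>_def power_mult_distrib[symmetric] mult_ac)
  finally have c: "(1 / \<theta>) ^ m * (1 / (1 - \<theta>)) ^ n \<le> (2 * exp 1 * (real n / real m)) ^ m" .
  have "((1 / \<theta>) ^ m * (1 / (1 - \<theta>)) ^ n) * (\<theta> ^ m * (1 - \<theta>) ^ n) = 1"
    using \<theta> by (simp add: power_one_over)
  then have "emeasure (leb m) dsect = ennreal (((1 / \<theta>) ^ m * (1 / (1 - \<theta>)) ^ n) * (\<theta> ^ m * (1 - \<theta>) ^ n)) * emeasure (leb m) dsect"
    by simp
  also have "\<dots> = ennreal ((1 / \<theta>) ^ m * (1 / (1 - \<theta>)) ^ n) * (ennreal (\<theta> ^ m * (1 - \<theta>) ^ n) * emeasure (leb m) dsect)"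
    using \<theta> by (subst ennreal_mult) (simp_all add: mult.assoc)
  also have "\<dots> \<le> ennreal ((1 / \<theta>) ^ m * (1 / (1 - \<theta>)) ^ n) * sup_sect"
    using \<theta> by (intro mult_left_mono dsect_scaled_bound) auto
  also have "\<dots> \<le> ennreal ((2 * exp 1 * (real n / real m)) ^ m) * sup_sect"
    by (intro mult_right_mono ennreal_leI c) simp
  finally show ?thesis .
qed

end

section \<open>Both bounds under one constant\<close>

theorem theorem1:
  shows "\<exists>C::real. C > 0 \<and>
    (\<forall>(m::nat) (n::nat) (K::(nat \<Rightarrow> real) set) (F::(nat \<Rightarrow> real) set).
       1 \<le> m \<and> m \<le> n \<and> convex_body n K \<and> subspace F \<and> F \<subseteq> Rn n \<and> dim F = m \<longrightarrow>
       emeasure (flat_lborel n F 0) (difference_body K \<inter> F)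
         \<le> ennreal (C ^ m * phi m n ^ m) *
           (SUP x\<in>Rn n. emeasure (flat_lborel n F x) (K \<inter> (\<lambda>y. y + x) ` F)))"
proof (intro exI conjI allI impI)
  \<comment> \<open>The sum dominates the constants of both bounds, and \<open>phi m n\<close> is
    always one of the two terms of its minimum.\<close>
  let ?C = "2 * exp 1 + exp 2 * gauss_const"
  have C: "2 * exp 1 \<le> ?C" "exp 2 * gauss_const \<le> ?C" using gauss_const_nonneg by simp_all
  show "?C > 0" using gauss_const_nonneg by (simp add: add_pos_nonneg)
  fix m n :: nat and K F :: "(nat \<Rightarrow> real) set"
  assume "1 \<le> m \<and> m \<le> n \<and> convex_body n K \<and> subspace F \<and> F \<subseteq> Rn n \<and> dim F = m"
  then interpret body_section m n K F by unfold_locales simp_all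
  have bound: "emeasure (leb m) dsect \<le> ennreal (?C ^ m * b ^ m) * sup_sect"
    if "emeasure (leb m) dsect \<le> ennreal ((c * b) ^ m) * sup_sect" "c \<le> ?C" "0 \<le> c" "0 \<le> b" for b c
  proof -
    have "(c * b) ^ m \<le> ?C ^ m * b ^ m"
      unfolding power_mult_distrib using that by (intro mult_right_mono power_mono) auto
    then have "ennreal ((c * b) ^ m) * sup_sect \<le> ennreal (?C ^ m * b ^ m) * sup_sect"
      by (intro mult_right_mono ennreal_leI) auto
    with that(1) show ?thesis by (rule order_trans)
  qed
  have "emeasure (leb m) dsect \<le> ennreal (?C ^ m * phi m n ^ m) * sup_sect"
    unfolding phi_def min_def
    using bound[OF ratio_bound C(1)] bound[OF sqrt_bound C(2)] gauss_const_nonneg by simp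
  then show "emeasure (flat_lborel n F 0) (difference_body K \<inter> F) \<le> ennreal (?C ^ m * phi m n ^ m) *
      (SUP x\<in>Rn n. emeasure (flat_lborel n F x) (K \<inter> (\<lambda>y. y + x) ` F))"
    unfolding emeasure_flat_dsect emeasure_flat_sect sup_sect_def .
qed

end
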